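(* Let $(M,g)$ be a Riemannian manifold of constant curvature $c$ and let $\mathbf F$ be a bundle-like foliation with totally umbilical leaves on $M$ with leaf dimension $p\ge 2$. If the transversal distribution $\mathbf H$ is non-integrable (i.e. $A\neq 0$ at every point) and the transversal curvature operator $R^*$ is Einstein-like, then $\mathbf F$ is totally geodesic.
   Context: All objects are $C^\infty$. $\mathbf F$ has codimension $q$. $\mathbf V$ is the distribution tangent to $\mathbf F$, $\mathbf H=\mathbf V^\perp$ its orthogonal complement; $\mathcal V E,\mathcal H E$ are the projections of $E$ to $\mathbf V,\mathbf H$. Sections of $\mathbf V$ (resp. $\mathbf H$) are vertical (resp. horizontal). A (local) basic vector field is a horizontal vector field which projects to a well-defined vector field under the local submersions defining $\mathbf F$. $\mathbf F$ is bundle-like with respect to $g$ if $W\,g(X,X)=0$ for every local basic $X$ and vertical $W$; equivalently the local submersions defining $\mathbf F$ are Riemannian submersions onto local quotients $B$. $D$ is the Levi-Civita connection of $g$. The O'Neill tensors are $T_EF=\mathcal V D_{\mathcal V E}\mathcal H F+\mathcal H D_{\mathcal V E}\mathcal V F$ and $A_EF=\mathcal V D_{\mathcal H E}\mathcal H F+\mathcal H D_{\mathcal H E}\mathcal V F$. The mean curvature vector field is $\tau=\sum_{i=1}^pT_{V_i}V_i$ for a local orthonormal frame $\{V_i\}$ of $\mathbf V$. The leaves are totally umbilical if $T_UV=\frac1p g(U,V)\tau$ for all vertical $U,V$; $\mathbf F$ is totally geodesic if its leaves are totally geodesic. The curvature convention is $R(E,F)G=D_ED_FG-D_FD_EG-D_{[E,F]}G$,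 $R(E,F,G,G')=-g(R(E,F)G,G')$. $R^*$ is the curvature tensor (same convention) of the transversal Levi-Civita connection $D^*$ on $\mathbf H$; on horizontal vectors it is the pullback of the curvature tensor of the local quotient $B$. $R^*$ is Einstein-like if there is a basic function $\lambda$ on $M$ (i.e. constant along leaves) such that $Ric^*(Y,Y)=\sum_{a=1}^qR^*(Y,X_a,Y,X_a)=\lambda\, g(Y,Y)$ for all horizontal $Y$, where $\{X_a\}_{1\le a\le q}$ is a local orthonormal frame of $\mathbf H$. *)

theory Defs
  imports "HOL-Analysis.Analysis"
begin

section \<open>Smooth maps\<close>

text \<open>For open \<open>S\<close> in a Euclidean space this is the class $C^k$; it is only used on open sets.\<close>

primrec Ck_on :: "nat \<Rightarrow> 'a set \<Rightarrow> ('a::real_normed_vector \<Rightarrow> 'b::real_normed_vector) \<Rightarrow> bool"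
  where
    "Ck_on 0 S f \<longleftrightarrow> continuous_on S f"
  | "Ck_on (Suc k) S f \<longleftrightarrow>
       (\<forall>x\<in>S. f differentiable (at x)) \<and> (\<forall>u. Ck_on k S (\<lambda>x. frechet_derivative f (at x) u))"

definition smooth_on :: "'a set \<Rightarrow> ('a::real_normed_vector \<Rightarrow> 'b::real_normed_vector) \<Rightarrow> bool"
  where "smooth_on S f \<longleftrightarrow> (\<forall>k. Ck_on k S f)"


section \<open>Smooth manifolds and Riemannian metrics\<close>

text \<open>
  A chart is a pair of its domain and its coordinate map; the values of the coordinate map outside
  the domain are irrelevant.  The manifold is the union of the chart domains, an open subset of the
  second countable Hausdorff space \<open>'m\<close>.  All charts take values in the fixed model space \<open>'e\<close>.
\<close>

type_synonym ('m, 'e) chart = "'m set \<times> ('m \<Rightarrow> 'e)"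

definition chart_image :: "('m, 'e) chart \<Rightarrow> 'e set"
  where "chart_image \<kappa> = snd \<kappa> ` fst \<kappa>"

definition chart_inv :: "('m, 'e) chart \<Rightarrow> 'e \<Rightarrow> 'm"
  where "chart_inv \<kappa> = inv_into (fst \<kappa>) (snd \<kappa>)"

definition is_chart :: "('m::topological_space, 'e::euclidean_space) chart \<Rightarrow> bool"
  where "is_chart \<kappa> \<longleftrightarrow> open (fst \<kappa>) \<and> open (chart_image \<kappa>) \<and>
    homeomorphism (fst \<kappa>) (chart_image \<kappa>) (snd \<kappa>) (chart_inv \<kappa>)"

definition overlap :: "('m, 'e) chart \<Rightarrow> ('m, 'e) chart \<Rightarrow> 'e set"
  where "overlap \<kappa> \<kappa>' = snd \<kappa> ` (fst \<kappa> \<inter> fst \<kappa>')"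

definition transition :: "('m, 'e) chart \<Rightarrow> ('m, 'e) chart \<Rightarrow> 'e \<Rightarrow> 'e"
  where "transition \<kappa> \<kappa>' = snd \<kappa>' \<circ> chart_inv \<kappa>"

definition compatible ::
    "('m, 'e::euclidean_space) chart \<Rightarrow> ('m, 'e) chart \<Rightarrow> bool"
  where "compatible \<kappa> \<kappa>' \<longleftrightarrow>
    smooth_on (overlap \<kappa> \<kappa>') (transition \<kappa> \<kappa>') \<and>
    smooth_on (overlap \<kappa>' \<kappa>) (transition \<kappa>' \<kappa>)"

definition points :: "('m, 'e) chart set \<Rightarrow> 'm set"
  where "points \<A> = \<Union>(fst ` \<A>)"

definition smooth_manifold ::
    "('m::{t2_space,second_countable_topology}, 'e::euclidean_space) chart set \<Rightarrow> bool"
  where "smooth_manifold \<A> \<longleftrightarrow>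
    (\<forall>\<kappa>\<in>\<A>. is_chart \<kappa>) \<and> (\<forall>\<kappa>\<in>\<A>. \<forall>\<kappa>'\<in>\<A>. compatible \<kappa> \<kappa>') \<and>
    (\<forall>\<kappa>. is_chart \<kappa> \<and> fst \<kappa> \<subseteq> points \<A> \<and> (\<forall>\<kappa>'\<in>\<A>. compatible \<kappa> \<kappa>') \<longrightarrow> \<kappa> \<in> \<A>)"

definition smooth_function :: "('m, 'e::euclidean_space) chart set \<Rightarrow> ('m \<Rightarrow> real) \<Rightarrow> bool"
  where "smooth_function \<A> f \<longleftrightarrow> (\<forall>\<kappa>\<in>\<A>. smooth_on (chart_image \<kappa>) (f \<circ> chart_inv \<kappa>))"

text \<open>A metric in coordinates: \<open>G x u v\<close> is the inner product of \<open>u\<close> and \<open>v\<close> at \<open>x\<close>.\<close>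

type_synonym 'e coord_metric = "'e \<Rightarrow> 'e \<Rightarrow> 'e \<Rightarrow> real"

definition coord_metric_on :: "'e::euclidean_space set \<Rightarrow> 'e coord_metric \<Rightarrow> bool"
  where "coord_metric_on S G \<longleftrightarrow>
    (\<forall>x\<in>S. bilinear (G x) \<and> (\<forall>u v. G x u v = G x v u) \<and> (\<forall>u. u \<noteq> 0 \<longrightarrow> G x u u > 0)) \<and>
    (\<forall>u v. smooth_on S (\<lambda>x. G x u v))"

text \<open>
  A Riemannian metric on the manifold is a family \<open>g\<close> of coordinate expressions, one for every
  chart, obeying the transformation law of a covariant 2-tensor.
\<close>

definition riemannian_metric ::
    "('m, 'e::euclidean_space) chart set \<Rightarrow> (('m, 'e) chart \<Rightarrow> 'e coord_metric) \<Rightarrow> bool"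
  where "riemannian_metric \<A> g \<longleftrightarrow>
    (\<forall>\<kappa>\<in>\<A>. coord_metric_on (chart_image \<kappa>) (g \<kappa>)) \<and>
    (\<forall>\<kappa>\<in>\<A>. \<forall>\<kappa>'\<in>\<A>. \<forall>x\<in>overlap \<kappa> \<kappa>'. \<forall>u v.
       g \<kappa> x u v = g \<kappa>' (transition \<kappa> \<kappa>' x)
         (frechet_derivative (transition \<kappa> \<kappa>') (at x) u)
         (frechet_derivative (transition \<kappa> \<kappa>') (at x) v))"


section \<open>Levi-Civita connection and curvature in a chart\<close>

definition lie_bracket ::
    "('e::euclidean_space \<Rightarrow> 'e) \<Rightarrow> ('e \<Rightarrow> 'e) \<Rightarrow> 'e \<Rightarrow> 'e"
  where "lie_bracket E F x =
    frechet_derivative F (at x) (E x) - frechet_derivative E (at x) (F x)"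

text \<open>The Koszul formula for constant-coefficient vector fields (whose brackets vanish).\<close>

definition christoffel :: "'e::euclidean_space coord_metric \<Rightarrow> 'e \<Rightarrow> 'e \<Rightarrow> 'e \<Rightarrow> 'e"
  where "christoffel G x u v = (THE w. \<forall>z. 2 * G x w z =
      frechet_derivative (\<lambda>y. G y v z) (at x) u
    + frechet_derivative (\<lambda>y. G y u z) (at x) v
    - frechet_derivative (\<lambda>y. G y u v) (at x) z)"

lemma coord_metric_riesz:
  assumes "coord_metric_on S G" "x \<in> S" "linear f"
  shows "\<exists>!w. \<forall>z. G x w z = f z"
proof -
  have b: "bilinear (G x)" and pos: "\<And>u. u \<noteq> 0 \<Longrightarrow> G x u u > 0"
    using assms(1,2) by (auto simp: coord_metric_on_def)
  define L where "L w = (\<Sum>b\<in>Basis. G x w b *\<^sub>R b)" for w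
  have linr: "linear (G x w)" and linl: "linear (\<lambda>w. G x w z)" for w z
    using b by (auto simp: bilinear_def)
  have L: "linear L"
    by (rule linearI)
      (simp_all add: L_def linear_add[OF linl] linear_cmul[OF linl] scaleR_add_left sum.distrib
        scaleR_sum_right)
  have Lb: "L w \<bullet> b = G x w b" if "b \<in> Basis" for w b
    using that by (simp add: L_def)
  have ext: "h = k" if "linear h" "linear k" "\<And>b. b \<in> Basis \<Longrightarrow> h b = k b" for h k :: "'a \<Rightarrow> real"
    using linear_eq_stdbasis[OF that] .
  have inj: "inj L"
  proof (rule linear_injective_0[OF L, THEN iffD2], intro allI impI)
    fix w assume "L w = 0"
    then have "G x w b = 0" if "b \<in> Basis" for b using Lb[OF that, of w] by simp
    then have "G x w = (\<lambda>_. 0)"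
      by (intro ext) (auto intro: linr linear_zero)
    then show "w = 0" using pos[of w] by fastforce
  qed
  then have "surj L" using L linear_injective_imp_surjective by blast
  then obtain w where w: "L w = (\<Sum>b\<in>Basis. f b *\<^sub>R b)" by (metis surjD)
  then have "G x w b = f b" if "b \<in> Basis" for b
    using that Lb[OF that, of w] by simp
  then have 1: "G x w = f" by (intro ext linr assms(3))
  have "w' = w" if "\<forall>z. G x w' z = f z" for w'
  proof -
    have "L w' = L w" unfolding L_def using that 1 by simp
    then show ?thesis using inj by (simp add: inj_eq)
  qed
  with 1 show ?thesis by auto
qed

text \<open>Torsion-freeness and metricity of the connection defined below.\<close>

lemma
  assumes "coord_metric_on S G" "open S" "x \<in> S"
  shows christoffel_sym: "christoffel G x u v = christoffel G x v u"
    and christoffel_metric: "frechet_derivative (\<lambda>y. G y u v) (at x) w =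
      G x (christoffel G x w u) v + G x u (christoffel G x w v)"
proof -
  let ?d = "\<lambda>u v. frechet_derivative (\<lambda>y. G y u v) (at x)"
  have bil: "bilinear (G y)" and sym: "G y u v = G y v u" if "y \<in> S" for y u v
    using assms(1) that by (auto simp: coord_metric_on_def)
  have diff: "(\<lambda>y. G y u v) differentiable (at x)" for u v
  proof -
    have "Ck_on (Suc 0) S (\<lambda>y. G y u v)"
      using assms(1) unfolding coord_metric_on_def smooth_on_def by blast
    then show ?thesis using assms(3) by simp
  qed
  note D = frechet_derivative_works[THEN iffD1, OF diff]
  have dz: "linear (\<lambda>z. ?d u v z)" for u v
    by (rule linear_frechet_derivative[OF diff])
  have congS: "frechet_derivative f (at x) = F"
    if "(h has_derivative F) (at x)" "\<And>y. y \<in> S \<Longrightarrow> h y = f y"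
    for f h :: "'a \<Rightarrow> real" and F
    using has_derivative_transform_within_open[OF that(1) assms(2,3) that(2)]
      frechet_derivative_at by metis
  have symd: "?d u v = ?d v u" for u v
    by (rule congS[OF D]) (rule sym)
  have lin2: "linear (\<lambda>z. ?d v z u)" for u v
  proof
    fix a b
    have "?d v (a + b) = (\<lambda>u. ?d v a u + ?d v b u)"
      by (rule congS[OF has_derivative_add[OF D D]]) (simp add: bilinear_radd bil)
    then show "?d v (a + b) u = ?d v a u + ?d v b u" by simp
  next
    fix r b
    have "?d v (r *\<^sub>R b) = (\<lambda>u. r *\<^sub>R ?d v b u)"
      by (rule congS[OF has_derivative_scaleR_right[OF D]])
        (use bilinear_rmul[OF bil] in simp)
    then show "?d v (r *\<^sub>R b) u = r *\<^sub>R ?d v b u" by simp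
  qed
  have koszul: "2 * G x (christoffel G x u v) z = ?d v z u + ?d u z v - ?d u v z" for u v z
  proof -
    define f where "f z = (?d v z u + ?d u z v - ?d u v z) / 2" for z
    have "linear (\<lambda>z. (1/2) *\<^sub>R (?d v z u + ?d u z v - ?d u v z))"
      by (intro linear_compose_scale_right linear_compose_sub linear_compose_add lin2 dz)
    then have "linear f" by (simp add: f_def[abs_def])
    from coord_metric_riesz[OF assms(1,3) this]
    have "\<exists>!w. \<forall>z. 2 * G x w z = ?d v z u + ?d u z v - ?d u v z"
      by (simp add: f_def field_simps)
    from theI'[OF this] show ?thesis unfolding christoffel_def by blast
  qed
  show "christoffel G x u v = christoffel G x v u"
    unfolding christoffel_def symd[of u v] by (simp add: add.commute)
  show "?d u v w = G x (christoffel G x w u) v + G x u (christoffel G x w v)"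
    using koszul[of w u v] koszul[of w v u] sym[OF assms(3), of u] symd[of u v] symd[of u w] symd[of v w]
    by simp
qed

definition levi_civita ::
    "'e::euclidean_space coord_metric \<Rightarrow> ('e \<Rightarrow> 'e) \<Rightarrow> ('e \<Rightarrow> 'e) \<Rightarrow> 'e \<Rightarrow> 'e"
  where "levi_civita G E F x = frechet_derivative F (at x) (E x) + christoffel G x (E x) (F x)"

text \<open>\<open>curvature D E F Z\<close> is $R(E,F)Z = D_E D_F Z - D_F D_E Z - D_{[E,F]} Z$.\<close>

definition curvature ::
    "(('e::euclidean_space \<Rightarrow> 'e) \<Rightarrow> ('e \<Rightarrow> 'e) \<Rightarrow> 'e \<Rightarrow> 'e) \<Rightarrow>
     ('e \<Rightarrow> 'e) \<Rightarrow> ('e \<Rightarrow> 'e) \<Rightarrow> ('e \<Rightarrow> 'e) \<Rightarrow> 'e \<Rightarrow> 'e"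
  where "curvature D E F Z x = D E (D F Z) x - D F (D E Z) x - D (lie_bracket E F) Z x"

text \<open>
  Tensors are defined on vector fields; their value on tangent vectors at \<open>x\<close> is obtained by
  extending the vectors to constant-coefficient fields of the chart, which is legitimate by
  tensoriality.  The sign in \<open>riem\<close> is the convention $R(E,F,G,G') = -g(R(E,F)G,G')$, for which
  $R(u,v,u,v)$ is positive on spheres.
\<close>

definition riem :: "'e::euclidean_space coord_metric \<Rightarrow> 'e \<Rightarrow> 'e \<Rightarrow> 'e \<Rightarrow> 'e \<Rightarrow> 'e \<Rightarrow> real"
  where "riem G x u v w z =
    - G x (curvature (levi_civita G) (\<lambda>_. u) (\<lambda>_. v) (\<lambda>_. w) x) z"

definition sectional_curvature :: "'e::euclidean_space coord_metric \<Rightarrow> 'e \<Rightarrow> 'e \<Rightarrow> 'e \<Rightarrow> real"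
  where "sectional_curvature G x u v =
    riem G x u v u v / (G x u u * G x v v - (G x u v)\<^sup>2)"

definition constant_curvature ::
    "('m, 'e::euclidean_space) chart set \<Rightarrow> (('m, 'e) chart \<Rightarrow> 'e coord_metric) \<Rightarrow> real \<Rightarrow> bool"
  where "constant_curvature \<A> g c \<longleftrightarrow>
    (\<forall>\<kappa>\<in>\<A>. \<forall>x\<in>chart_image \<kappa>. \<forall>u v. u \<noteq> v \<and> independent {u, v} \<longrightarrow>
       sectional_curvature (g \<kappa>) x u v = c)"


section \<open>Foliations\<close>

text \<open>
  A foliation is given by a foliated atlas inside the smooth structure: charts with values in
  \<open>'v \<times> 'h\<close> whose transition maps are locally of the form $(y,z) \mapsto (h_1(y,z), h_2(z))$.
  The leaf dimension is \<open>DIM('v)\<close> and the codimension is \<open>DIM('h)\<close>.  The submersions defining the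
  foliation are the second components \<open>snd \<circ> \<phi>\<close> of the foliated charts \<open>\<phi>\<close>.
\<close>

definition foliation ::
    "('m, 'v::euclidean_space \<times> 'h::euclidean_space) chart set \<Rightarrow> ('m, 'v \<times> 'h) chart set \<Rightarrow> bool"
  where "foliation \<A> \<F> \<longleftrightarrow> \<F> \<subseteq> \<A> \<and> points \<F> = points \<A> \<and>
    (\<forall>\<kappa>\<in>\<F>. \<forall>\<kappa>'\<in>\<F>. \<forall>x\<in>overlap \<kappa> \<kappa>'. \<exists>N h. open N \<and> x \<in> N \<and> N \<subseteq> overlap \<kappa> \<kappa>' \<and>
       (\<forall>y\<in>N. snd (transition \<kappa> \<kappa>' y) = h (snd y)))"

text \<open>
  Two points are in the same leaf if they are joined by a chain of plaques (connected pieces of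
  fibres of the defining submersions).
\<close>

definition same_plaque :: "('m::topological_space, 'v \<times> 'h) chart set \<Rightarrow> 'm \<Rightarrow> 'm \<Rightarrow> bool"
  where "same_plaque \<F> a b \<longleftrightarrow>
    (\<exists>\<kappa>\<in>\<F>. \<exists>C z. connected C \<and> C \<subseteq> fst \<kappa> \<and> a \<in> C \<and> b \<in> C \<and> (\<forall>s\<in>C. snd (snd \<kappa> s) = z))"

definition same_leaf :: "('m::topological_space, 'v \<times> 'h) chart set \<Rightarrow> 'm \<Rightarrow> 'm \<Rightarrow> bool"
  where "same_leaf \<F> = (same_plaque \<F>)\<^sup>*\<^sup>*"

definition basic_function ::
    "('m::topological_space, 'v::euclidean_space \<times> 'h::euclidean_space) chart set \<Rightarrow>
     ('m, 'v \<times> 'h) chart set \<Rightarrow> ('m \<Rightarrow> real) \<Rightarrow> bool"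
  where "basic_function \<A> \<F> f \<longleftrightarrow> smooth_function \<A> f \<and>
    (\<forall>a\<in>points \<A>. \<forall>b\<in>points \<A>. same_leaf \<F> a b \<longrightarrow> f a = f b)"


subsection \<open>Geometry of a metric in a foliated chart\<close>

text \<open>In a foliated chart the tangent distribution of the leaves is \<open>'v \<times> {0}\<close> at every point.\<close>

definition vertical_space :: "('v::euclidean_space \<times> 'h::euclidean_space) set"
  where "vertical_space = {u. snd u = 0}"

definition horizontal_space ::
    "('v::euclidean_space \<times> 'h::euclidean_space) coord_metric \<Rightarrow> 'v \<times> 'h \<Rightarrow> ('v \<times> 'h) set"
  where "horizontal_space G x = {u. \<forall>v\<in>vertical_space. G x u v = 0}"

definition vproj ::
    "('v::euclidean_space \<times> 'h::euclidean_space) coord_metric \<Rightarrow> 'v \<times> 'h \<Rightarrow> 'v \<times> 'h \<Rightarrow> 'v \<times> 'h"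
  where "vproj G x u = (THE w. w \<in> vertical_space \<and> u - w \<in> horizontal_space G x)"

definition hproj ::
    "('v::euclidean_space \<times> 'h::euclidean_space) coord_metric \<Rightarrow> 'v \<times> 'h \<Rightarrow> 'v \<times> 'h \<Rightarrow> 'v \<times> 'h"
  where "hproj G x u = u - vproj G x u"

definition vpart ::
    "('v::euclidean_space \<times> 'h::euclidean_space) coord_metric \<Rightarrow>
     ('v \<times> 'h \<Rightarrow> 'v \<times> 'h) \<Rightarrow> 'v \<times> 'h \<Rightarrow> 'v \<times> 'h"
  where "vpart G E = (\<lambda>x. vproj G x (E x))"

definition hpart ::
    "('v::euclidean_space \<times> 'h::euclidean_space) coord_metric \<Rightarrow>
     ('v \<times> 'h \<Rightarrow> 'v \<times> 'h) \<Rightarrow> 'v \<times> 'h \<Rightarrow> 'v \<times> 'h"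
  where "hpart G E = (\<lambda>x. hproj G x (E x))"

definition oneill_T ::
    "('v::euclidean_space \<times> 'h::euclidean_space) coord_metric \<Rightarrow>
     ('v \<times> 'h \<Rightarrow> 'v \<times> 'h) \<Rightarrow> ('v \<times> 'h \<Rightarrow> 'v \<times> 'h) \<Rightarrow> 'v \<times> 'h \<Rightarrow> 'v \<times> 'h"
  where "oneill_T G E F x =
    vproj G x (levi_civita G (vpart G E) (hpart G F) x) +
    hproj G x (levi_civita G (vpart G E) (vpart G F) x)"

definition oneill_A ::
    "('v::euclidean_space \<times> 'h::euclidean_space) coord_metric \<Rightarrow>
     ('v \<times> 'h \<Rightarrow> 'v \<times> 'h) \<Rightarrow> ('v \<times> 'h \<Rightarrow> 'v \<times> 'h) \<Rightarrow> 'v \<times> 'h \<Rightarrow> 'v \<times> 'h"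
  where "oneill_A G E F x =
    vproj G x (levi_civita G (hpart G E) (hpart G F) x) +
    hproj G x (levi_civita G (hpart G E) (vpart G F) x)"

definition T_at ::
    "('v::euclidean_space \<times> 'h::euclidean_space) coord_metric \<Rightarrow>
     'v \<times> 'h \<Rightarrow> 'v \<times> 'h \<Rightarrow> 'v \<times> 'h \<Rightarrow> 'v \<times> 'h"
  where "T_at G x u v = oneill_T G (\<lambda>_. u) (\<lambda>_. v) x"

definition A_at ::
    "('v::euclidean_space \<times> 'h::euclidean_space) coord_metric \<Rightarrow>
     'v \<times> 'h \<Rightarrow> 'v \<times> 'h \<Rightarrow> 'v \<times> 'h \<Rightarrow> 'v \<times> 'h"
  where "A_at G x u v = oneill_A G (\<lambda>_. u) (\<lambda>_. v) x"

definition orthonormal_basis ::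
    "('e::euclidean_space \<Rightarrow> 'e \<Rightarrow> real) \<Rightarrow> 'e set \<Rightarrow> 'e set \<Rightarrow> bool"
  where "orthonormal_basis ip S B \<longleftrightarrow> finite B \<and> B \<subseteq> S \<and> span B = S \<and>
    (\<forall>a\<in>B. \<forall>b\<in>B. ip a b = (if a = b then 1 else 0))"

text \<open>The following two traces do not depend on the orthonormal basis chosen.\<close>

definition mean_curvature ::
    "('v::euclidean_space \<times> 'h::euclidean_space) coord_metric \<Rightarrow> 'v \<times> 'h \<Rightarrow> 'v \<times> 'h"
  where "mean_curvature G x =
    (\<Sum>b\<in>(SOME B. orthonormal_basis (G x) vertical_space B). T_at G x b b)"

text \<open>
  The transversal Levi-Civita connection on sections \<open>Y\<close> of the horizontal bundle:
  $D^*_X Y = \mathcal{H} D_X Y$ for horizontal $X$ and $D^*_V Y = \mathcal{H} [V,Y]$ for vertical $V$.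
\<close>

definition transversal_connection ::
    "('v::euclidean_space \<times> 'h::euclidean_space) coord_metric \<Rightarrow>
     ('v \<times> 'h \<Rightarrow> 'v \<times> 'h) \<Rightarrow> ('v \<times> 'h \<Rightarrow> 'v \<times> 'h) \<Rightarrow> 'v \<times> 'h \<Rightarrow> 'v \<times> 'h"
  where "transversal_connection G E Y x =
    hproj G x (levi_civita G (hpart G E) Y x) + hproj G x (lie_bracket (vpart G E) Y x)"

definition transversal_riem ::
    "('v::euclidean_space \<times> 'h::euclidean_space) coord_metric \<Rightarrow> 'v \<times> 'h \<Rightarrow>
     'v \<times> 'h \<Rightarrow> 'v \<times> 'h \<Rightarrow> 'v \<times> 'h \<Rightarrow> 'v \<times> 'h \<Rightarrow> real"
  where "transversal_riem G x u v w z =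
    - G x (curvature (transversal_connection G) (\<lambda>_. u) (\<lambda>_. v) (hpart G (\<lambda>_. w)) x) z"

definition transversal_ric ::
    "('v::euclidean_space \<times> 'h::euclidean_space) coord_metric \<Rightarrow> 'v \<times> 'h \<Rightarrow> 'v \<times> 'h \<Rightarrow> real"
  where "transversal_ric G x u =
    (\<Sum>b\<in>(SOME B. orthonormal_basis (G x) (horizontal_space G x) B). transversal_riem G x u b u b)"

text \<open>Horizontal fields on \<open>W\<close> projecting to a well-defined field under the local submersion.\<close>

definition basic_field ::
    "('v::euclidean_space \<times> 'h::euclidean_space) coord_metric \<Rightarrow> ('v \<times> 'h) set \<Rightarrow>
     ('v \<times> 'h \<Rightarrow> 'v \<times> 'h) \<Rightarrow> bool"
  where "basic_field G W X \<longleftrightarrow> smooth_on W X \<and> (\<forall>x\<in>W. X x \<in> horizontal_space G x) \<and>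
    (\<exists>Y. \<forall>x\<in>W. snd (X x) = Y (snd x))"


subsection \<open>Properties of a foliation of a Riemannian manifold\<close>

definition bundle_like ::
    "('m, 'v::euclidean_space \<times> 'h::euclidean_space) chart set \<Rightarrow>
     (('m, 'v \<times> 'h) chart \<Rightarrow> ('v \<times> 'h) coord_metric) \<Rightarrow> bool"
  where "bundle_like \<F> g \<longleftrightarrow>
    (\<forall>\<kappa>\<in>\<F>. \<forall>W X. open W \<and> W \<subseteq> chart_image \<kappa> \<and> basic_field (g \<kappa>) W X \<longrightarrow>
       (\<forall>x\<in>W. \<forall>w\<in>vertical_space.
          frechet_derivative (\<lambda>y. g \<kappa> y (X y) (X y)) (at x) w = 0))"

definition totally_umbilical ::
    "('m, 'v::euclidean_space \<times> 'h::euclidean_space) chart set \<Rightarrow>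
     (('m, 'v \<times> 'h) chart \<Rightarrow> ('v \<times> 'h) coord_metric) \<Rightarrow> bool"
  where "totally_umbilical \<F> g \<longleftrightarrow>
    (\<forall>\<kappa>\<in>\<F>. \<forall>x\<in>chart_image \<kappa>. \<forall>u\<in>vertical_space. \<forall>v\<in>vertical_space.
       T_at (g \<kappa>) x u v = (1 / real DIM('v) * g \<kappa> x u v) *\<^sub>R mean_curvature (g \<kappa>) x)"

text \<open>On vertical vectors \<open>T\<close> is the second fundamental form of the leaves.\<close>

definition totally_geodesic ::
    "('m, 'v::euclidean_space \<times> 'h::euclidean_space) chart set \<Rightarrow>
     (('m, 'v \<times> 'h) chart \<Rightarrow> ('v \<times> 'h) coord_metric) \<Rightarrow> bool"
  where "totally_geodesic \<F> g \<longleftrightarrow>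
    (\<forall>\<kappa>\<in>\<F>. \<forall>x\<in>chart_image \<kappa>. \<forall>u\<in>vertical_space. \<forall>v\<in>vertical_space. T_at (g \<kappa>) x u v = 0)"

definition horizontally_nonintegrable ::
    "('m, 'v::euclidean_space \<times> 'h::euclidean_space) chart set \<Rightarrow>
     (('m, 'v \<times> 'h) chart \<Rightarrow> ('v \<times> 'h) coord_metric) \<Rightarrow> bool"
  where "horizontally_nonintegrable \<F> g \<longleftrightarrow>
    (\<forall>\<kappa>\<in>\<F>. \<forall>x\<in>chart_image \<kappa>. \<exists>u v. A_at (g \<kappa>) x u v \<noteq> 0)"

definition transversally_einstein_like ::
    "('m::topological_space, 'v::euclidean_space \<times> 'h::euclidean_space) chart set \<Rightarrow>
     ('m, 'v \<times> 'h) chart set \<Rightarrow> (('m, 'v \<times> 'h) chart \<Rightarrow> ('v \<times> 'h) coord_metric) \<Rightarrow> bool"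
  where "transversally_einstein_like \<A> \<F> g \<longleftrightarrow>
    (\<exists>l. basic_function \<A> \<F> l \<and>
       (\<forall>\<kappa>\<in>\<F>. \<forall>x\<in>chart_image \<kappa>. \<forall>y\<in>horizontal_space (g \<kappa>) x.
          transversal_ric (g \<kappa>) x y = l (chart_inv \<kappa> x) * g \<kappa> x y y))"

end

theory Submission
  imports Defs
begin

text \<open>
  The argument is local and is carried out in a single foliated chart.  Write $N = \tau/p$ for the
  normalised mean curvature field, so that $T_U V = g(U,V) N$; the claim is $N = 0$.  The idea is that
  the hypotheses make the integrability tensor \<open>A\<close> conformal, and that the Codazzi equation for \<open>A\<close>
  then prescribes the derivative of the conformal factor in two incompatible ways unless $N = 0$.

  Conformality comes from two curvature equations.  For horizontal \<open>X\<close> and vertical \<open>V\<close> the mixed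
  equation of an umbilical Riemannian foliation expresses $|A_X V|^2 / |V|^2$ by a quantity depending
  on \<open>X\<close> alone (lemma \<open>tensA_conformal_vertical\<close>).  O'Neill's horizontal equation
  $R(X,Y,X,Y) = R^*(X,Y,X,Y) - 3 |A_X Y|^2$, traced over \<open>Y\<close>, turns the Einstein condition into the
  statement that $\sum_Y |A_X Y|^2 = \sum_V |A_X V|^2$ is proportional to $|X|^2$.  Together,
  $|A_X V|^2 = m |X|^2 |V|^2$ for a function \<open>m\<close> (lemma \<open>tensA_conformal\<close>), which has no
  zeros since \<open>A\<close> has none.

  The curvature identity $R(X,Y,Z,V) = 0$ for three horizontal vectors and a vertical one determines
  the covariant derivative of \<open>A\<close> in horizontal directions (lemma \<open>tensA_derivative\<close>).
  Differentiating the conformality relation in the direction of a horizontal \<open>W\<close> therefore gives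
  \[ \textstyle\frac12 W(m) |X|^2 |V|^2 = m\, g(N,X) g(W,X) |V|^2 + g(N, A_X V)\, g(W, A_X V)
     + m\, g(N,W) |X|^2 |V|^2 \]
  (lemma \<open>conformal_derivative\<close>).  Put $W = N$.  Since $A_N V$ is orthogonal to \<open>N\<close>, the choice
  $X = N$ yields $\frac12 N(m) = 2 m |N|^2$ if $N \neq 0$.  As $p \ge 2$ there is a vertical
  $E \neq 0$ orthogonal to \<open>V\<close>; for $X = A_N E$ conformality makes the first two terms on the right vanish,
  and $\frac12 N(m) = m |N|^2$.  Hence $m |N|^2 = 0$, which is the contradiction (lemma \<open>N_eq_0\<close>).
\<close>

section \<open>Smooth maps on open sets\<close>

lemma frechet_derivative_cong_open:
  assumes "open S" "x \<in> S" "\<And>y. y \<in> S \<Longrightarrow> f y = h y"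
  shows "frechet_derivative f (at x) = frechet_derivative h (at x)"
proof -
  have "(f has_derivative F) (at x) \<longleftrightarrow> (h has_derivative F) (at x)" for F
    using has_derivative_transform_within_open[OF _ assms(1,2), of f F UNIV h]
      has_derivative_transform_within_open[OF _ assms(1,2), of h F UNIV f] assms(3) by metis
  then show ?thesis by (simp add: frechet_derivative_def)
qed

lemma differentiable_cong_open:
  assumes "f differentiable (at x)" "open S" "x \<in> S" "\<And>y. y \<in> S \<Longrightarrow> f y = h y"
  shows "h differentiable (at x)"
  using has_derivative_transform_within_open[OF _ assms(2,3), of f _ UNIV h] assms(1,4)
  unfolding differentiable_def by metis

lemma Ck_on_cong:
  assumes "open S" "\<And>x. x \<in> S \<Longrightarrow> f x = h x" "Ck_on k S f"
  shows "Ck_on k S h"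
  using assms(2,3)
proof (induction k arbitrary: f h)
  case 0
  then show ?case using continuous_on_cong[of S S f h] by simp
next
  case (Suc k)
  have eq: "frechet_derivative f (at x) = frechet_derivative h (at x)" if "x \<in> S" for x
    using frechet_derivative_cong_open[OF assms(1) that] Suc.prems(1) by blast
  have "h differentiable (at x)" if "x \<in> S" for x
    using differentiable_cong_open[OF _ assms(1) that, of f h] Suc.prems that by simp
  moreover have "Ck_on k S (\<lambda>x. frechet_derivative h (at x) u)" for u
    using Suc.IH[of "\<lambda>x. frechet_derivative f (at x) u"] Suc.prems(2) eq by simp
  ultimately show ?case by simp
qed

lemma Ck_on_Suc_imp:
  assumes "Ck_on (Suc k) S f" shows "Ck_on k S f"
  using assms
proof (induction k arbitrary: f)
  case 0
  then show ?case
    by (auto intro!: continuous_at_imp_continuous_on differentiable_imp_continuous_within)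
next
  case (Suc k)
  then show ?case by (metis Ck_on.simps(2))
qed

lemma Ck_on_SucI:
  assumes "open S" "\<And>x. x \<in> S \<Longrightarrow> (f has_derivative F x) (at x)"
    "\<And>u. Ck_on k S (\<lambda>x. F x u)"
  shows "Ck_on (Suc k) S f"
proof -
  have "frechet_derivative f (at x) = F x" if "x \<in> S" for x
    using frechet_derivative_at[OF assms(2)[OF that]] by simp
  then have "Ck_on k S (\<lambda>x. frechet_derivative f (at x) u)" for u
    using Ck_on_cong[OF assms(1) _ assms(3)[of u]] by simp
  moreover have "f differentiable (at x)" if "x \<in> S" for x
    using assms(2)[OF that] by (auto simp: differentiable_def)
  ultimately show ?thesis by simp
qed

lemma Ck_on_SucD:
  assumes "Ck_on (Suc k) S f"
  shows "x \<in> S \<Longrightarrow> (f has_derivative frechet_derivative f (at x)) (at x)"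
    and "Ck_on k S (\<lambda>x. frechet_derivative f (at x) u)"
  using assms frechet_derivative_works by auto

lemma Ck_on_const:
  assumes "open S" shows "Ck_on k S (\<lambda>_. c)"
proof (induction k arbitrary: c)
  case (Suc k)
  show ?case by (rule Ck_on_SucI[OF assms has_derivative_const Suc])
qed simp

lemma Ck_on_linear:
  assumes "open S" "bounded_linear h" "Ck_on k S f" shows "Ck_on k S (\<lambda>x. h (f x))"
  using assms(3)
proof (induction k arbitrary: f)
  case 0
  then show ?case using bounded_linear.continuous_on[OF assms(2)] by simp
next
  case (Suc k)
  show ?case
    by (rule Ck_on_SucI[OF assms(1) bounded_linear.has_derivative[OF assms(2)
        Ck_on_SucD(1)[OF Suc.prems]]])
      (auto intro!: Suc.IH Ck_on_SucD(2) Suc.prems)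
qed

lemma Ck_on_add:
  assumes "open S" "Ck_on k S f" "Ck_on k S h" shows "Ck_on k S (\<lambda>x. f x + h x)"
  using assms(2,3)
proof (induction k arbitrary: f h)
  case 0
  then show ?case by (auto intro: continuous_on_add)
next
  case (Suc k)
  show ?case
    by (rule Ck_on_SucI[OF assms(1) has_derivative_add[OF Ck_on_SucD(1)[OF Suc.prems(1)]
      Ck_on_SucD(1)[OF Suc.prems(2)]]]) 
      (auto intro!: Suc.IH Ck_on_SucD(2) Suc.prems)
qed

lemma Ck_on_bilinear:
  assumes "open S" "bounded_bilinear p" "Ck_on k S f" "Ck_on k S h"
  shows "Ck_on k S (\<lambda>x. p (f x) (h x))"
  using assms(3,4)
proof (induction k arbitrary: f h)
  case 0
  then show ?case using bounded_bilinear.continuous_on[OF assms(2)] by auto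
next
  case (Suc k)
  show ?case
  proof (rule Ck_on_SucI[OF assms(1)])
    show "((\<lambda>x. p (f x) (h x)) has_derivative (\<lambda>u. p (f x) (frechet_derivative h (at x) u) +
        p (frechet_derivative f (at x) u) (h x))) (at x)" if "x \<in> S" for x
      using bounded_bilinear.FDERIV[OF assms(2) Ck_on_SucD(1)[OF Suc.prems(1) that]
          Ck_on_SucD(1)[OF Suc.prems(2) that]] .
    show "Ck_on k S (\<lambda>x. p (f x) (frechet_derivative h (at x) u) +
        p (frechet_derivative f (at x) u) (h x))" for u
      by (intro Ck_on_add[OF assms(1)] Suc.IH Ck_on_SucD(2)[OF Suc.prems(1)]
          Ck_on_SucD(2)[OF Suc.prems(2)] Ck_on_Suc_imp[OF Suc.prems(1)] Ck_on_Suc_imp[OF Suc.prems(2)])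
  qed
qed

text \<open>
  Stated for all exponents at once, because differentiation lowers the exponent.  Quotients and
  normalisation by a square root are instances.
\<close>

lemma Ck_on_powr:
  assumes "open S" "Ck_on k S f" "\<And>x. x \<in> S \<Longrightarrow> f x > (0::real)"
  shows "Ck_on k S (\<lambda>x. f x powr a)"
  using assms(2)
proof (induction k arbitrary: a)
  case 0
  then show ?case using assms(3) by (force intro!: continuous_on_powr)
next
  case (Suc k)
  have "((\<lambda>x. f x powr a) has_derivative
      (\<lambda>u. frechet_derivative f (at x) u * (a * f x powr (a - 1)))) (at x)" if "x \<in> S" for x
    using has_derivative_compose[OF Ck_on_SucD(1)[OF Suc.prems that]
      has_real_derivative_powr[OF assms(3)[OF that], of a, unfolded has_field_derivative_def]]
    by (simp add: mult_ac)
  moreover have "Ck_on k S (\<lambda>x. frechet_derivative f (at x) u * (a * f x powr (a - 1)))" for u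
    using Ck_on_SucD(2)[OF Suc.prems] Ck_on_const[OF assms(1)] Suc.IH[OF Ck_on_Suc_imp[OF Suc.prems]]
    by (intro Ck_on_bilinear[OF assms(1) bounded_bilinear_mult])
  ultimately show ?case
    using Ck_on_SucI[OF assms(1), of "\<lambda>x. f x powr a"
        "\<lambda>x u. frechet_derivative f (at x) u * (a * f x powr (a - 1))" k] by blast
qed

named_theorems smooth_intros

lemma smooth_on_cong:
  "open S \<Longrightarrow> (\<And>x. x \<in> S \<Longrightarrow> f x = h x) \<Longrightarrow> smooth_on S f \<Longrightarrow> smooth_on S h"
  unfolding smooth_on_def using Ck_on_cong by blast

lemma smooth_on_const [smooth_intros]: "open S \<Longrightarrow> smooth_on S (\<lambda>_. c)"
  by (simp add: smooth_on_def Ck_on_const)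

lemma smooth_on_add [smooth_intros]:
  "open S \<Longrightarrow> smooth_on S f \<Longrightarrow> smooth_on S h \<Longrightarrow> smooth_on S (\<lambda>x. f x + h x)"
  by (simp add: smooth_on_def Ck_on_add)

lemma smooth_on_linear:
  "open S \<Longrightarrow> bounded_linear L \<Longrightarrow> smooth_on S f \<Longrightarrow> smooth_on S (\<lambda>x. L (f x))"
  by (simp add: smooth_on_def Ck_on_linear)

lemma smooth_on_bilinear:
  "open S \<Longrightarrow> bounded_bilinear p \<Longrightarrow> smooth_on S f \<Longrightarrow> smooth_on S h
    \<Longrightarrow> smooth_on S (\<lambda>x. p (f x) (h x))"
  by (simp add: smooth_on_def Ck_on_bilinear)

lemma smooth_on_mult [smooth_intros]:
  fixes f h :: "'a::real_normed_vector \<Rightarrow> real"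
  shows "open S \<Longrightarrow> smooth_on S f \<Longrightarrow> smooth_on S h \<Longrightarrow> smooth_on S (\<lambda>x. f x * h x)"
  by (rule smooth_on_bilinear[OF _ bounded_bilinear_mult])

lemma smooth_on_scaleR [smooth_intros]:
  "open S \<Longrightarrow> smooth_on S f \<Longrightarrow> smooth_on S h \<Longrightarrow> smooth_on S (\<lambda>x. f x *\<^sub>R h x)"
  by (rule smooth_on_bilinear[OF _ bounded_bilinear_scaleR])

lemma smooth_on_inner [smooth_intros]:
  "open S \<Longrightarrow> smooth_on S f \<Longrightarrow> smooth_on S h \<Longrightarrow> smooth_on S (\<lambda>x. f x \<bullet> h x)"
  by (rule smooth_on_bilinear[OF _ bounded_bilinear_inner])

lemma smooth_on_powr [smooth_intros]:
  "open S \<Longrightarrow> smooth_on S f \<Longrightarrow> (\<And>x. x \<in> S \<Longrightarrow> f x > (0::real)) \<Longrightarrow> smooth_on S (\<lambda>x. f x powr a)"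
  by (simp add: smooth_on_def Ck_on_powr)

lemma smooth_on_minus [smooth_intros]:
  "open S \<Longrightarrow> smooth_on S f \<Longrightarrow> smooth_on S (\<lambda>x. - f x)"
  by (rule smooth_on_linear[OF _ bounded_linear_minus[OF bounded_linear_ident]])

lemma smooth_on_diff [smooth_intros]:
  "open S \<Longrightarrow> smooth_on S f \<Longrightarrow> smooth_on S h \<Longrightarrow> smooth_on S (\<lambda>x. f x - h x)"
  using smooth_on_add[OF _ _ smooth_on_minus] by fastforce

lemma smooth_on_divide [smooth_intros]:
  fixes f h :: "'a::real_normed_vector \<Rightarrow> real"
  assumes "open S" "smooth_on S f" "smooth_on S h" "\<And>x. x \<in> S \<Longrightarrow> h x > 0"
  shows "smooth_on S (\<lambda>x. f x / h x)"
proof (rule smooth_on_cong[OF assms(1)])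
  show "smooth_on S (\<lambda>x. f x * h x powr (-1))"
    by (intro smooth_intros assms)
  show "f x * h x powr (-1) = f x / h x" if "x \<in> S" for x
    using assms(4)[OF that] by (simp add: powr_minus divide_inverse)
qed

lemma smooth_on_sum [smooth_intros]:
  "open S \<Longrightarrow> (\<And>i. i \<in> I \<Longrightarrow> smooth_on S (f i)) \<Longrightarrow> smooth_on S (\<lambda>x. \<Sum>i\<in>I. f i x)"
  by (induction I rule: infinite_finite_induct) (auto intro!: smooth_on_const smooth_on_add)

lemma smooth_on_has_derivative:
  "smooth_on S f \<Longrightarrow> x \<in> S \<Longrightarrow> (f has_derivative frechet_derivative f (at x)) (at x)"
  unfolding smooth_on_def using Ck_on_SucD(1) by blast

text \<open>
  Smoothness is defined through derivatives in constant directions, so a variable direction is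
  expanded in the standard basis.
\<close>

lemma smooth_on_frechet:
  fixes f :: "'a::euclidean_space \<Rightarrow> 'b::real_normed_vector"
  assumes "open S" "smooth_on S f" "smooth_on S X"
  shows "smooth_on S (\<lambda>x. frechet_derivative f (at x) (X x))"
proof (rule smooth_on_cong[OF assms(1)])
  have "smooth_on S (\<lambda>x. frechet_derivative f (at x) u)" for u
    using assms(2) unfolding smooth_on_def using Ck_on_SucD(2) by blast
  then show "smooth_on S (\<lambda>x. \<Sum>b\<in>Basis. (X x \<bullet> b) *\<^sub>R frechet_derivative f (at x) b)"
    by (intro smooth_intros assms)
  show "(\<Sum>b\<in>Basis. (X x \<bullet> b) *\<^sub>R frechet_derivative f (at x) b) =
      frechet_derivative f (at x) (X x)" if "x \<in> S" for x
  proof -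
    have "linear (frechet_derivative f (at x))"
      using smooth_on_has_derivative[OF assms(2) that] has_derivative_linear by blast
    from linear_sum[OF this, of "\<lambda>b. (X x \<bullet> b) *\<^sub>R b" Basis] show ?thesis
      by (simp add: linear_cmul[OF \<open>linear _\<close>] euclidean_representation)
  qed
qed

text \<open>
  The mean value theorem is applied to the second difference twice, first along \<open>u\<close> and then
  along \<open>v\<close>.
\<close>

lemma second_difference_mean_value:
  fixes f :: "'a::euclidean_space \<Rightarrow> real"
  assumes "open S" "smooth_on S f" "t > 0"
    and box: "\<And>a b. 0 \<le> a \<Longrightarrow> a \<le> t \<Longrightarrow> 0 \<le> b \<Longrightarrow> b \<le> t \<Longrightarrow> x + a *\<^sub>R u + b *\<^sub>R v \<in> S"
  shows "\<exists>a b. 0 \<le> a \<and> a \<le> t \<and> 0 \<le> b \<and> b \<le> t \<and>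
    f (x + t *\<^sub>R u + t *\<^sub>R v) - f (x + t *\<^sub>R u) - f (x + t *\<^sub>R v) + f x =
    t * t * frechet_derivative (\<lambda>y. frechet_derivative f (at y) u) (at (x + a *\<^sub>R u + b *\<^sub>R v)) v"
proof -
  define fu where "fu y = frechet_derivative f (at y) u" for y
  have fu: "smooth_on S fu"
    unfolding fu_def using smooth_on_frechet[OF assms(1,2) smooth_on_const[OF assms(1)]] .
  have lin: "linear (frechet_derivative h (at y))" if "y \<in> S" "smooth_on S h" for y and h :: "'a \<Rightarrow> real"
    using smooth_on_has_derivative[OF that(2,1)] has_derivative_linear by blast
  have 1: "((\<lambda>a. f (x + a *\<^sub>R u + t *\<^sub>R v) - f (x + a *\<^sub>R u)) has_derivative
      (\<lambda>r. frechet_derivative f (at (x + a *\<^sub>R u + t *\<^sub>R v)) (r *\<^sub>R u) -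
           frechet_derivative f (at (x + a *\<^sub>R u)) (r *\<^sub>R u))) (at a within {0..t})"
    if "0 \<le> a" "a \<le> t" for a
    by (rule has_derivative_at_withinI, rule has_derivative_diff)
      (rule has_derivative_compose[OF _ smooth_on_has_derivative[OF assms(2)]],
        use box[OF that, of t] box[OF that, of 0] assms(3) in \<open>auto intro!: derivative_eq_intros\<close>)+
  obtain a where a: "0 < a" "a < t"
    "f (x + t *\<^sub>R u + t *\<^sub>R v) - f (x + t *\<^sub>R u) - (f (x + t *\<^sub>R v) - f x) =
      frechet_derivative f (at (x + a *\<^sub>R u + t *\<^sub>R v)) (t *\<^sub>R u) -
           frechet_derivative f (at (x + a *\<^sub>R u)) (t *\<^sub>R u)"
    using mvt_simple[OF assms(3) 1] by auto
  have 2: "((\<lambda>b. fu (x + a *\<^sub>R u + b *\<^sub>R v)) has_derivative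
      (\<lambda>r. frechet_derivative fu (at (x + a *\<^sub>R u + b *\<^sub>R v)) (r *\<^sub>R v))) (at b within {0..t})"
    if "0 \<le> b" "b \<le> t" for b
    by (rule has_derivative_at_withinI)
      (rule has_derivative_compose[OF _ smooth_on_has_derivative[OF fu]],
        use box[of a b] a that in \<open>auto intro!: derivative_eq_intros\<close>)
  obtain b where b: "0 < b" "b < t"
    "fu (x + a *\<^sub>R u + t *\<^sub>R v) - fu (x + a *\<^sub>R u) =
      frechet_derivative fu (at (x + a *\<^sub>R u + b *\<^sub>R v)) (t *\<^sub>R v)"
    using mvt_simple[OF assms(3) 2] by auto
  have S: "x + a *\<^sub>R u + t *\<^sub>R v \<in> S" "x + a *\<^sub>R u \<in> S" "x + a *\<^sub>R u + b *\<^sub>R v \<in> S"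
    using box[of a t] box[of a 0] box[of a b] a b by auto
  have "f (x + t *\<^sub>R u + t *\<^sub>R v) - f (x + t *\<^sub>R u) - f (x + t *\<^sub>R v) + f x =
      t * (fu (x + a *\<^sub>R u + t *\<^sub>R v) - fu (x + a *\<^sub>R u))"
    using a(3)
    unfolding linear_cmul[OF lin[OF S(1) assms(2)]] linear_cmul[OF lin[OF S(2) assms(2)]] fu_def
    by (simp add: right_diff_distrib)
  also have "\<dots> = t * t * frechet_derivative fu (at (x + a *\<^sub>R u + b *\<^sub>R v)) v"
    using b(3) by (simp add: linear_cmul[OF lin[OF S(3) fu]])
  finally show ?thesis using a b unfolding fu_def[abs_def]
    by (intro exI[of _ a] exI[of _ b]) auto
qed

text \<open>
  The second difference of \<open>f\<close> is symmetric in \<open>u\<close> and \<open>v\<close>, and by the preceding lemma it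
  approximates either mixed derivative.
\<close>

lemma frechet_derivative_commute:
  fixes f :: "'a::euclidean_space \<Rightarrow> real"
  assumes "open S" "smooth_on S f" "x \<in> S"
  shows "frechet_derivative (\<lambda>y. frechet_derivative f (at y) u) (at x) v =
    frechet_derivative (\<lambda>y. frechet_derivative f (at y) v) (at x) u"
proof -
  let ?h = "\<lambda>u v y. frechet_derivative (\<lambda>y. frechet_derivative f (at y) u) (at y) v"
  have cont: "isCont (?h u v) x" for u v
  proof -
    have "smooth_on S (?h u v)"
      by (intro smooth_on_frechet smooth_intros assms)
    then show ?thesis using smooth_on_has_derivative[OF _ assms(3)] has_derivative_continuous by blast
  qed
  have "\<bar>?h u v x - ?h v u x\<bar> < 2 * e" if "e > 0" for e
  proof -
    obtain d1 where d1: "d1 > 0" "\<And>y. dist y x < d1 \<Longrightarrow> dist (?h u v y) (?h u v x) < e"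
      using cont[of u v] \<open>e > 0\<close> unfolding continuous_at_eps_delta by meson
    obtain d2 where d2: "d2 > 0" "\<And>y. dist y x < d2 \<Longrightarrow> dist (?h v u y) (?h v u x) < e"
      using cont[of v u] \<open>e > 0\<close> unfolding continuous_at_eps_delta by meson
    obtain d3 where d3: "d3 > 0" "ball x d3 \<subseteq> S"
      using assms(1,3) openE by blast
    define d where "d = min d1 (min d2 d3)"
    define t where "t = d / (2 * (norm u + norm v + 1))"
    have pos: "0 < norm u + norm v + 1" by (simp add: add_nonneg_pos)
    have d: "d > 0" using d1 d2 d3 by (simp add: d_def)
    have t: "t > 0" "t * (norm u + norm v) < d"
    proof -
      show "t > 0" using d pos by (simp add: t_def)
      have "norm u + norm v < 2 * (norm u + norm v + 1)"
        using pos by argo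
      then have "t * (norm u + norm v) < t * (2 * (norm u + norm v + 1))"
        using \<open>t > 0\<close> by simp
      also have "\<dots> = d" using pos by (simp add: t_def)
      finally show "t * (norm u + norm v) < d" .
    qed
    have near: "dist (x + a *\<^sub>R u + b *\<^sub>R v) x < d" if "0 \<le> a" "a \<le> t" "0 \<le> b" "b \<le> t" for a b
    proof -
      have "dist (x + a *\<^sub>R u + b *\<^sub>R v) x \<le> a * norm u + b * norm v"
        using norm_triangle_ineq[of "a *\<^sub>R u" "b *\<^sub>R v"] that by (simp add: dist_norm add.assoc)
      also have "\<dots> \<le> t * norm u + t * norm v"
        using that by (intro add_mono mult_right_mono) auto
      finally show ?thesis using t(2) by (simp add: algebra_simps)
    qed
    have near': "dist (x + a *\<^sub>R v + b *\<^sub>R u) x < d" if "0 \<le> a" "a \<le> t" "0 \<le> b" "b \<le> t" for a b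
      using near[OF that(3,4,1,2)] by (simp add: add_ac)
    have S: "y \<in> S" if "dist y x < d" for y
      using that d3(2) by (auto simp: d_def dist_commute subset_iff)
    obtain a b where ab: "0 \<le> a" "a \<le> t" "0 \<le> b" "b \<le> t"
      "f (x + t *\<^sub>R u + t *\<^sub>R v) - f (x + t *\<^sub>R u) - f (x + t *\<^sub>R v) + f x =
        t * t * ?h u v (x + a *\<^sub>R u + b *\<^sub>R v)"
      using second_difference_mean_value[OF assms(1,2) t(1), of x u v] near S by blast
    obtain a' b' where ab': "0 \<le> a'" "a' \<le> t" "0 \<le> b'" "b' \<le> t"
      "f (x + t *\<^sub>R v + t *\<^sub>R u) - f (x + t *\<^sub>R v) - f (x + t *\<^sub>R u) + f x =
        t * t * ?h v u (x + a' *\<^sub>R v + b' *\<^sub>R u)"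
      using second_difference_mean_value[OF assms(1,2) t(1), of x v u] near' S by blast
    have eq: "x + t *\<^sub>R v + t *\<^sub>R u = x + t *\<^sub>R u + t *\<^sub>R v" by (simp add: add_ac)
    have "t * t * ?h u v (x + a *\<^sub>R u + b *\<^sub>R v) = t * t * ?h v u (x + a' *\<^sub>R v + b' *\<^sub>R u)"
      using ab(5) ab'(5) unfolding eq by linarith
    then have "?h u v (x + a *\<^sub>R u + b *\<^sub>R v) = ?h v u (x + a' *\<^sub>R v + b' *\<^sub>R u)"
      using t(1) by simp
    moreover have "dist (?h u v (x + a *\<^sub>R u + b *\<^sub>R v)) (?h u v x) < e"
      using near[OF ab(1-4)] by (intro d1(2)) (simp add: d_def)
    moreover have "dist (?h v u (x + a' *\<^sub>R v + b' *\<^sub>R u)) (?h v u x) < e"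
      using near'[OF ab'(1-4)] by (intro d2(2)) (simp add: d_def)
    ultimately show ?thesis by (simp add: dist_real_def)
  qed
  note * = this
  show ?thesis
  proof (rule ccontr)
    assume "\<not> ?thesis"
    then have "\<bar>?h u v x - ?h v u x\<bar> / 2 > 0" by simp
    from *[OF this] show False by simp
  qed
qed

lemma frechet_derivative_commute_vector:
  fixes f :: "'a::euclidean_space \<Rightarrow> 'b::euclidean_space"
  assumes "open S" "smooth_on S f" "x \<in> S"
  shows "frechet_derivative (\<lambda>y. frechet_derivative f (at y) u) (at x) v =
    frechet_derivative (\<lambda>y. frechet_derivative f (at y) v) (at x) u"
proof (rule euclidean_eqI)
  fix b :: 'b assume "b \<in> Basis"
  have comp: "frechet_derivative (\<lambda>y. h y \<bullet> b) (at y) w = frechet_derivative h (at y) w \<bullet> b"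
    if "y \<in> S" "smooth_on S h" for y w and h :: "'a \<Rightarrow> 'b"
    using frechet_derivative_at[OF bounded_linear.has_derivative[OF bounded_linear_inner_left
        smooth_on_has_derivative[OF that(2,1)], of b]] by metis
  have "frechet_derivative (\<lambda>y. frechet_derivative f (at y) u) (at x) v \<bullet> b =
      frechet_derivative (\<lambda>y. frechet_derivative (\<lambda>y. f y \<bullet> b) (at y) u) (at x) v" for u v
  proof -
    have "frechet_derivative (\<lambda>y. frechet_derivative f (at y) u) (at x) v \<bullet> b =
        frechet_derivative (\<lambda>y. frechet_derivative f (at y) u \<bullet> b) (at x) v"
      by (rule comp[symmetric]) (intro smooth_on_frechet smooth_intros assms)+
    also have "\<dots> = frechet_derivative (\<lambda>y. frechet_derivative (\<lambda>y. f y \<bullet> b) (at y) u) (at x) v"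
      by (subst frechet_derivative_cong_open[OF assms(1,3)]) (simp_all add: comp assms)
    finally show ?thesis .
  qed
  moreover have "smooth_on S (\<lambda>y. f y \<bullet> b)"
    by (intro smooth_intros assms)
  ultimately show "frechet_derivative (\<lambda>y. frechet_derivative f (at y) u) (at x) v \<bullet> b =
      frechet_derivative (\<lambda>y. frechet_derivative f (at y) v) (at x) u \<bullet> b"
    using frechet_derivative_commute[OF assms(1) _ assms(3)] by metis
qed


section \<open>Riemannian metrics on an open set\<close>

text \<open>
  Reduces the smoothness of a field of bilinear maps, evaluated on vector fields, to the smoothness of
  its coefficients.
\<close>

lemma bilinear_expand:
  fixes h :: "'a::euclidean_space \<Rightarrow> 'b::euclidean_space \<Rightarrow> 'c::real_vector"
  assumes "bilinear h"
  shows "h u v = (\<Sum>b\<in>Basis. \<Sum>c\<in>Basis. (u \<bullet> b) *\<^sub>R ((v \<bullet> c) *\<^sub>R h b c))"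
proof -
  have "h u v = h (\<Sum>b\<in>Basis. (u \<bullet> b) *\<^sub>R b) (\<Sum>c\<in>Basis. (v \<bullet> c) *\<^sub>R c)"
    by (simp add: euclidean_representation)
  then show ?thesis
    by (simp only: bilinear_sum[OF assms] sum.cartesian_product[symmetric] bilinear_lmul[OF assms]
        bilinear_rmul[OF assms] scaleR_left_commute)
qed

text \<open>
  One product rule that serves for the metric, for the Christoffel terms and for the derivative of a
  field in a variable direction: all of them are families of linear maps applied to a vector field.
\<close>

lemma frechet_derivative_linear_family:
  fixes L :: "'a::euclidean_space \<Rightarrow> 'b::euclidean_space \<Rightarrow> 'c::real_normed_vector"
  assumes "open S" "x \<in> S" "\<And>y. y \<in> S \<Longrightarrow> linear (L y)" "\<And>v. smooth_on S (\<lambda>y. L y v)" "smooth_on S Y"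
  shows "frechet_derivative (\<lambda>y. L y (Y y)) (at x) w =
    frechet_derivative (\<lambda>y. L y (Y x)) (at x) w + L x (frechet_derivative Y (at x) w)"
proof -
  have expand: "(\<Sum>b\<in>Basis. (v \<bullet> b) *\<^sub>R L y b) = L y v" if "y \<in> S" for y v
    using linear_sum[OF assms(3)[OF that], of "\<lambda>b. (v \<bullet> b) *\<^sub>R b" Basis]
    by (simp add: linear_cmul[OF assms(3)[OF that]] euclidean_representation)
  let ?dL = "\<lambda>b. frechet_derivative (\<lambda>y. L y b) (at x)"
  let ?dY = "frechet_derivative Y (at x)"
  have dL: "((\<lambda>y. L y b) has_derivative ?dL b) (at x)" for b
    by (rule smooth_on_has_derivative[OF assms(4,2)])
  have dY: "((\<lambda>y. Y y \<bullet> b) has_derivative (\<lambda>w. ?dY w \<bullet> b)) (at x)" for b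
    by (rule bounded_linear.has_derivative[OF bounded_linear_inner_left
        smooth_on_has_derivative[OF assms(5,2)]])
  have "((\<lambda>y. \<Sum>b\<in>Basis. (Y y \<bullet> b) *\<^sub>R L y b) has_derivative
      (\<lambda>w. \<Sum>b\<in>Basis. (Y x \<bullet> b) *\<^sub>R ?dL b w + (?dY w \<bullet> b) *\<^sub>R L x b)) (at x)"
    by (intro has_derivative_sum has_derivative_scaleR dL dY)
  then have 1: "((\<lambda>y. L y (Y y)) has_derivative
      (\<lambda>w. \<Sum>b\<in>Basis. (Y x \<bullet> b) *\<^sub>R ?dL b w + (?dY w \<bullet> b) *\<^sub>R L x b)) (at x)"
    by (rule has_derivative_transform_within_open[OF _ assms(1,2) expand])
  have "((\<lambda>y. \<Sum>b\<in>Basis. (Y x \<bullet> b) *\<^sub>R L y b) has_derivative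
      (\<lambda>w. \<Sum>b\<in>Basis. (Y x \<bullet> b) *\<^sub>R ?dL b w)) (at x)"
    by (intro has_derivative_sum has_derivative_scaleR_right dL)
  then have 2: "((\<lambda>y. L y (Y x)) has_derivative (\<lambda>w. \<Sum>b\<in>Basis. (Y x \<bullet> b) *\<^sub>R ?dL b w)) (at x)"
    by (rule has_derivative_transform_within_open[OF _ assms(1,2) expand])
  show ?thesis
    unfolding fun_cong[OF frechet_derivative_at[OF 1], of w, symmetric]
      fun_cong[OF frechet_derivative_at[OF 2], of w, symmetric]
    by (simp add: sum.distrib expand[OF assms(2)])
qed

locale riemannian_domain =
  fixes S :: "'e::euclidean_space set" and G :: "'e coord_metric"
  assumes open_S: "open S" and metric: "coord_metric_on S G"
begin

lemma bilinear_G: "x \<in> S \<Longrightarrow> bilinear (G x)"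
  and G_commute: "x \<in> S \<Longrightarrow> G x u v = G x v u"
  and G_pos: "x \<in> S \<Longrightarrow> u \<noteq> 0 \<Longrightarrow> G x u u > 0"
  and smooth_G_const: "smooth_on S (\<lambda>x. G x u v)"
  using metric by (auto simp: coord_metric_on_def)

lemma G_simps [simp]:
  assumes "x \<in> S"
  shows "G x (u + v) w = G x u w + G x v w" "G x w (u + v) = G x w u + G x w v"
    "G x (u - v) w = G x u w - G x v w" "G x w (u - v) = G x w u - G x w v"
    "G x (r *\<^sub>R u) w = r * G x u w" "G x w (r *\<^sub>R u) = r * G x w u"
    "G x (- u) w = - G x u w" "G x w (- u) = - G x w u"
    "G x 0 w = 0" "G x w 0 = 0"
  using bilinear_G[OF assms]
  by (simp_all add: bilinear_ladd bilinear_radd bilinear_lsub bilinear_rsub bilinear_lmul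
      bilinear_rmul bilinear_lneg bilinear_rneg bilinear_lzero bilinear_rzero)

lemma G_sum:
  assumes "x \<in> S"
  shows G_sum_left: "G x (sum f I) w = (\<Sum>i\<in>I. G x (f i) w)"
    and G_sum_right: "G x w (sum f I) = (\<Sum>i\<in>I. G x w (f i))"
  using assms by (induction I rule: infinite_finite_induct) auto

lemma G_eq_0_iff: "x \<in> S \<Longrightarrow> G x u u = 0 \<longleftrightarrow> u = 0"
  using G_pos[of x u] by fastforce

lemma G_eqI:
  assumes "x \<in> S" "\<And>w. G x u w = G x v w" shows "u = v"
  using assms G_eq_0_iff[of x "u - v"] by simp

lemma smooth_on_G [smooth_intros]:
  assumes "smooth_on S X" "smooth_on S Y"
  shows "smooth_on S (\<lambda>x. G x (X x) (Y x))"
proof (rule smooth_on_cong[OF open_S])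
  show "smooth_on S (\<lambda>x. \<Sum>b\<in>Basis. \<Sum>c\<in>Basis. (X x \<bullet> b) * ((Y x \<bullet> c) * G x b c))"
    by (intro smooth_intros assms smooth_G_const open_S)
  show "(\<Sum>b\<in>Basis. \<Sum>c\<in>Basis. (X x \<bullet> b) * ((Y x \<bullet> c) * G x b c)) = G x (X x) (Y x)" if "x \<in> S" for x
    using bilinear_expand[OF bilinear_G[OF that], of "X x" "Y x"] by simp
qed

subsection \<open>Orthonormal frames\<close>

text \<open>
  The members of the frame are labelled by the constant vectors from which they are produced.
\<close>

definition smooth_frame :: "'e set \<Rightarrow> ('e \<Rightarrow> 'e \<Rightarrow> 'e) \<Rightarrow> bool"
  where "smooth_frame B E \<longleftrightarrow> (\<forall>b\<in>B. smooth_on S (E b)) \<and>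
    (\<forall>x\<in>S. span ((\<lambda>b. E b x) ` B) = span B \<and>
      (\<forall>a\<in>B. \<forall>b\<in>B. G x (E a x) (E b x) = (if a = b then 1 else 0)))"

text \<open>
  Gram--Schmidt, performed at all points of the domain simultaneously; each step only involves sums,
  products and the inverse square root of a positive function, so the frame is smooth.
\<close>

lemma smooth_frame_exists:
  assumes "finite B" "independent B"
  shows "\<exists>E. smooth_frame B E"
  using assms
proof (induction B)
  case empty
  then show ?case by (simp add: smooth_frame_def)
next
  case (insert c B)
  then obtain E where E: "smooth_frame B E" using independent_insert by metis
  have c: "c \<notin> span B" using insert by (simp add: independent_insert)
  have smE: "smooth_on S (E b)" if "b \<in> B" for b using E that by (auto simp: smooth_frame_def)
  have spE: "span ((\<lambda>b. E b x) ` B) = span B" if "x \<in> S" for x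
    using E that by (auto simp: smooth_frame_def)
  have onE: "G x (E a x) (E b x) = (if a = b then 1 else 0)" if "x \<in> S" "a \<in> B" "b \<in> B" for x a b
    using E that by (auto simp: smooth_frame_def)
  define p where "p x = (\<Sum>b\<in>B. G x c (E b x) *\<^sub>R E b x)" for x
  define w where "w x = c - p x" for x
  have p: "p x \<in> span B" if "x \<in> S" for x
    unfolding p_def spE[OF that, symmetric] by (intro span_sum span_scale span_base) auto
  have w_pos: "G x (w x) (w x) > 0" if "x \<in> S" for x
  proof (rule G_pos[OF that])
    show "w x \<noteq> 0" using p[OF that] c by (auto simp: w_def)
  qed
  have w_orth: "G x (w x) (E b x) = 0" if "x \<in> S" "b \<in> B" for x b
    using that insert.hyps(1) by (simp add: w_def p_def G_sum onE if_distrib cong: if_cong)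
  have w_smooth: "smooth_on S w"
    unfolding w_def p_def by (intro smooth_intros open_S smE)
  (* The exponent normalises w; w has no zeros because c is not in the span of B. *)
  define e where "e x = (G x (w x) (w x)) powr (-1/2) *\<^sub>R w x" for x
  define E' where "E' b = (if b = c then e else E b)" for b
  have E'B: "E' b = E b" if "b \<in> B" for b using that insert.hyps by (auto simp: E'_def)
  have E'c: "E' c = e" by (simp add: E'_def)
  have e_smooth: "smooth_on S e"
    unfolding e_def by (intro smooth_intros open_S w_smooth w_pos)
  have e_unit: "G x (e x) (e x) = 1" if "x \<in> S" for x
  proof -
    let ?g = "G x (w x) (w x)"
    have "?g powr (-1/2) * (?g powr (-1/2) * ?g powr 1) = 1"
      using w_pos[OF that] by (simp only: powr_add[symmetric]) simp
    then show ?thesis using w_pos[OF that] that by (simp add: e_def)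
  qed
  have e_orth: "G x (e x) (E b x) = 0" "G x (E b x) (e x) = 0" if "x \<in> S" "b \<in> B" for x b
    using w_orth[OF that] that by (simp_all add: e_def G_commute[of x "E b x"])
  have "span ((\<lambda>b. E' b x) ` insert c B) = span (insert c B)" if "x \<in> S" for x
  proof -
    let ?r = "(G x (w x) (w x)) powr (-1/2)"
    have r: "?r \<noteq> 0" using w_pos[OF that] by simp
    have im: "(\<lambda>b. E' b x) ` insert c B = insert (e x) ((\<lambda>b. E b x) ` B)"
      using E'B E'c by auto
    have le: "span ((\<lambda>b. E b x) ` B) \<subseteq> span (insert y ((\<lambda>b. E b x) ` B))" for y
      by (intro span_mono) auto
    have le': "span B \<subseteq> span (insert c B)" by (intro span_mono) auto
    have "p x \<in> span (insert c B)" using p[OF that] le' by blast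
    then have "e x \<in> span (insert c B)"
      unfolding e_def w_def by (intro span_scale span_diff) (auto intro: span_base)
    moreover have "E b x \<in> span (insert c B)" if "b \<in> B" for b
      using that le' spE[OF \<open>x \<in> S\<close>] span_base[of "E b x" "(\<lambda>b. E b x) ` B"] by auto
    moreover have "c \<in> span (insert (e x) ((\<lambda>b. E b x) ` B))"
    proof -
      have "c = (1 / ?r) *\<^sub>R e x + p x" using r by (simp add: e_def w_def)
      moreover have "p x \<in> span (insert (e x) ((\<lambda>b. E b x) ` B))"
        using p[OF that] spE[OF that] le by blast
      ultimately show ?thesis by (metis insertI1 span_add span_base span_scale)
    qed
    moreover have "b \<in> span (insert (e x) ((\<lambda>b. E b x) ` B))" if "b \<in> B" for b
      using that le spE[OF \<open>x \<in> S\<close>] span_base[of b B] by auto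
    ultimately show ?thesis
      unfolding im by (intro equalityI span_minimal subspace_span) auto
  qed
  then have "smooth_frame (insert c B) E'"
    unfolding smooth_frame_def using smE e_smooth onE e_unit e_orth insert.hyps
    by (auto simp: E'B E'c)
  then show ?case by blast
qed

lemma orthonormal_expansion:
  assumes "x \<in> S" "finite B" "\<And>a b. a \<in> B \<Longrightarrow> b \<in> B \<Longrightarrow> G x (e a) (e b) = (if a = b then 1 else 0)"
    "u \<in> span (e ` B)"
  shows "u = (\<Sum>b\<in>B. G x u (e b) *\<^sub>R e b)"
  using assms(4)
proof (induction u rule: span_induct_alt)
  case base
  then show ?case using assms(1) by simp
next
  case (step c a y)
  then obtain b0 where b0: "a = e b0" "b0 \<in> B" by auto
  have "(\<Sum>b\<in>B. G x (c *\<^sub>R a + y) (e b) *\<^sub>R e b) =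
      (\<Sum>b\<in>B. c *\<^sub>R (G x (e b0) (e b) *\<^sub>R e b)) + (\<Sum>b\<in>B. G x y (e b) *\<^sub>R e b)"
    using assms(1) by (simp add: b0 scaleR_add_left sum.distrib)
  also have "(\<Sum>b\<in>B. c *\<^sub>R (G x (e b0) (e b) *\<^sub>R e b)) = c *\<^sub>R a"
  proof -
    have "(\<Sum>b\<in>B. c *\<^sub>R (G x (e b0) (e b) *\<^sub>R e b)) = (\<Sum>b\<in>B. if b = b0 then c *\<^sub>R e b else 0)"
      using assms(3) b0(2) by (intro sum.cong) auto
    then show ?thesis using b0 assms(2) by simp
  qed
  finally show ?case using step by simp
qed

lemma orthonormal_expansion_G:
  assumes "x \<in> S" "finite B" "\<And>a b. a \<in> B \<Longrightarrow> b \<in> B \<Longrightarrow> G x (e a) (e b) = (if a = b then 1 else 0)"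
    "u \<in> span (e ` B)"
  shows "G x u w = (\<Sum>b\<in>B. G x u (e b) * G x (e b) w)"
  using arg_cong[OF orthonormal_expansion[OF assms], of "\<lambda>u. G x u w"] assms(1)
  by (simp add: G_sum)

subsection \<open>The Levi-Civita connection\<close>

text \<open>
  A covariant derivative depends on its direction only through the value at the point.  The pointwise
  form allows directions that are not given as fields.
\<close>

definition cov :: "'e \<Rightarrow> 'e \<Rightarrow> ('e \<Rightarrow> 'e) \<Rightarrow> 'e"
  where "cov x w Y = frechet_derivative Y (at x) w + christoffel G x w (Y x)"

lemma levi_civita_cov: "levi_civita G E F x = cov x (E x) F"
  by (simp add: levi_civita_def cov_def)

lemma cov_const: "cov x w (\<lambda>_. v) = christoffel G x w v"
  by (simp add: cov_def)

text \<open>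
  The Christoffel term is specified as a unique solution; its characterising equation is recovered
  from symmetry and metricity, and yields linearity and smoothness.
\<close>

lemma koszul:
  assumes "x \<in> S"
  shows "2 * G x (christoffel G x u v) z =
    frechet_derivative (\<lambda>y. G y v z) (at x) u + frechet_derivative (\<lambda>y. G y u z) (at x) v
    - frechet_derivative (\<lambda>y. G y u v) (at x) z"
  using christoffel_metric[OF metric open_S assms, of v z u]
    christoffel_metric[OF metric open_S assms, of u z v]
    christoffel_metric[OF metric open_S assms, of u v z]
    christoffel_sym[OF metric open_S assms] G_commute[OF assms]
  by (smt (verit))

lemma christoffel_commute: "x \<in> S \<Longrightarrow> christoffel G x u v = christoffel G x v u"
  by (rule christoffel_sym[OF metric open_S])

lemma christoffel_linear:
  assumes "x \<in> S" shows "linear (christoffel G x u)"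
proof -
  have d: "(\<lambda>y. G y u v) differentiable at x" for u v
    using smooth_on_has_derivative[OF smooth_G_const assms] differentiable_def by blast
  note hd = d[THEN frechet_derivative_works[THEN iffD1]]
  have lin: "linear (frechet_derivative (\<lambda>y. G y u v) (at x))" for u v
    using hd has_derivative_linear by blast
  have add: "frechet_derivative (\<lambda>y. G y (a + b) z) (at x) = 
      (\<lambda>w. frechet_derivative (\<lambda>y. G y a z) (at x) w + frechet_derivative (\<lambda>y. G y b z) (at x) w)" for a b z
    using frechet_derivative_cong_open[OF open_S assms, of "\<lambda>y. G y (a + b) z" "\<lambda>y. G y a z + G y b z"]
      frechet_derivative_at[OF has_derivative_add[OF hd hd]] by simp
  have scale: "frechet_derivative (\<lambda>y. G y (r *\<^sub>R a) z) (at x) = 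
      (\<lambda>w. r * frechet_derivative (\<lambda>y. G y a z) (at x) w)" for r a z
    using frechet_derivative_cong_open[OF open_S assms, of "\<lambda>y. G y (r *\<^sub>R a) z" "\<lambda>y. r * G y a z"]
      frechet_derivative_at[OF has_derivative_mult_right[OF hd]] by simp
  have sym: "frechet_derivative (\<lambda>y. G y u v) (at x) = frechet_derivative (\<lambda>y. G y v u) (at x)" for u v
    by (rule frechet_derivative_cong_open[OF open_S assms G_commute])
  show ?thesis
  proof
    show "christoffel G x u (a + b) = christoffel G x u a + christoffel G x u b" for a b
    proof (rule G_eqI[OF assms])
      fix w
      have "2 * G x (christoffel G x u (a + b)) w =
          2 * G x (christoffel G x u a) w + 2 * G x (christoffel G x u b) w"
        using assms by (simp add: koszul add sym[of u] linear_add[OF lin] del: G_simps)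
      then show "G x (christoffel G x u (a + b)) w = G x (christoffel G x u a + christoffel G x u b) w"
        using assms by simp
    qed
    show "christoffel G x u (r *\<^sub>R a) = r *\<^sub>R christoffel G x u a" for r a
    proof (rule G_eqI[OF assms])
      fix w
      have "2 * G x (christoffel G x u (r *\<^sub>R a)) w = r * (2 * G x (christoffel G x u a) w)"
        using assms
        by (simp add: koszul scale sym[of u] linear_cmul[OF lin] right_diff_distrib distrib_left del: G_simps)
      then show "G x (christoffel G x u (r *\<^sub>R a)) w = G x (r *\<^sub>R christoffel G x u a) w"
        using assms by simp
    qed
  qed
qed

lemma christoffel_bilinear:
  assumes "x \<in> S" shows "bilinear (christoffel G x)"
  unfolding bilinear_def
  using christoffel_linear[OF assms] christoffel_commute[OF assms]
  by (metis (no_types, lifting) ext)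

lemma christoffel_simps [simp]:
  assumes "x \<in> S"
  shows "christoffel G x (u + v) w = christoffel G x u w + christoffel G x v w"
    "christoffel G x w (u + v) = christoffel G x w u + christoffel G x w v"
    "christoffel G x (u - v) w = christoffel G x u w - christoffel G x v w"
    "christoffel G x w (u - v) = christoffel G x w u - christoffel G x w v"
    "christoffel G x (r *\<^sub>R u) w = r *\<^sub>R christoffel G x u w"
    "christoffel G x w (r *\<^sub>R u) = r *\<^sub>R christoffel G x w u"
    "christoffel G x (- u) w = - christoffel G x u w" "christoffel G x w (- u) = - christoffel G x w u"
    "christoffel G x 0 w = 0" "christoffel G x w 0 = 0"
  using christoffel_bilinear[OF assms]
  by (simp_all add: bilinear_ladd bilinear_radd bilinear_lsub bilinear_rsub bilinear_lmul
      bilinear_rmul bilinear_lneg bilinear_rneg bilinear_lzero bilinear_rzero)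

text \<open>
  In a smooth orthonormal frame the components are given by the right-hand side of the Koszul formula.
\<close>

lemma smooth_on_christoffel_const: "smooth_on S (\<lambda>x. christoffel G x u v)"
proof -
  obtain E where E: "smooth_frame (Basis :: 'e set) E"
    using smooth_frame_exists[OF finite_Basis independent_Basis] by blast
  have smE: "smooth_on S (E b)" if "b \<in> Basis" for b using E that by (auto simp: smooth_frame_def)
  let ?k = "\<lambda>x z. frechet_derivative (\<lambda>y. G y v z) (at x) u + frechet_derivative (\<lambda>y. G y u z) (at x) v
    - frechet_derivative (\<lambda>y. G y u v) (at x) z"
  have k: "smooth_on S (\<lambda>x. ?k x z)" for z
    by (intro smooth_intros open_S smooth_on_frechet smooth_G_const)
  show ?thesis
  proof (rule smooth_on_cong[OF open_S])
    show "smooth_on S (\<lambda>x. \<Sum>b\<in>Basis. \<Sum>c\<in>Basis. ((1/2) * ?k x c * (E b x \<bullet> c)) *\<^sub>R E b x)"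
      by (intro smooth_intros open_S smE k)
    fix x assume x: "x \<in> S"
    have k_G: "G x (christoffel G x u v) (E b x) = (\<Sum>c\<in>Basis. (1/2) * ?k x c * (E b x \<bullet> c))" for b
    proof -
      have "G x (christoffel G x u v) (E b x) =
          G x (christoffel G x u v) (\<Sum>c\<in>Basis. (E b x \<bullet> c) *\<^sub>R c)"
        by (simp add: euclidean_representation)
      also have "\<dots> = (\<Sum>c\<in>Basis. (E b x \<bullet> c) * G x (christoffel G x u v) c)"
        using x by (simp add: G_sum)
      also have "\<dots> = (\<Sum>c\<in>Basis. (1/2) * ?k x c * (E b x \<bullet> c))"
        by (intro sum.cong refl) (simp add: koszul[OF x, symmetric])
      finally show ?thesis .
    qed
    have "christoffel G x u v = (\<Sum>b\<in>Basis. G x (christoffel G x u v) (E b x) *\<^sub>R E b x)"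
      using E x by (intro orthonormal_expansion[of x Basis "\<lambda>b. E b x"]) (auto simp: smooth_frame_def)
    then show "(\<Sum>b\<in>Basis. \<Sum>c\<in>Basis. ((1/2) * ?k x c * (E b x \<bullet> c)) *\<^sub>R E b x) = christoffel G x u v"
      by (simp only: k_G scaleR_sum_left)
  qed
qed

lemma smooth_on_christoffel [smooth_intros]:
  assumes "smooth_on S X" "smooth_on S Y"
  shows "smooth_on S (\<lambda>x. christoffel G x (X x) (Y x))"
proof (rule smooth_on_cong[OF open_S])
  show "smooth_on S (\<lambda>x. \<Sum>b\<in>Basis. \<Sum>c\<in>Basis. (X x \<bullet> b) *\<^sub>R ((Y x \<bullet> c) *\<^sub>R christoffel G x b c))"
    by (intro smooth_intros assms smooth_on_christoffel_const open_S)
  show "(\<Sum>b\<in>Basis. \<Sum>c\<in>Basis. (X x \<bullet> b) *\<^sub>R ((Y x \<bullet> c) *\<^sub>R christoffel G x b c)) =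
      christoffel G x (X x) (Y x)" if "x \<in> S" for x
    using bilinear_expand[OF christoffel_bilinear[OF that], of "X x" "Y x"] by simp
qed

lemma smooth_on_cov [smooth_intros]:
  assumes "smooth_on S X" "smooth_on S Y"
  shows "smooth_on S (\<lambda>x. cov x (X x) Y)"
  unfolding cov_def by (intro smooth_intros smooth_on_frechet open_S assms)

lemma cov_linear:
  assumes "x \<in> S" "smooth_on S Y" shows "linear (\<lambda>w. cov x w Y)"
proof -
  have "linear (frechet_derivative Y (at x))"
    using smooth_on_has_derivative[OF assms(2,1)] has_derivative_linear by blast
  moreover have "linear (\<lambda>w. christoffel G x w (Y x))"
    using christoffel_bilinear[OF assms(1)] by (simp add: bilinear_def)
  ultimately show ?thesis unfolding cov_def by (rule linear_compose_add)
qed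

lemma cov_cong:
  assumes "x \<in> S" "\<And>y. y \<in> S \<Longrightarrow> Y y = Z y"
  shows "cov x w Y = cov x w Z"
  using frechet_derivative_cong_open[OF open_S assms] assms by (simp add: cov_def)

lemma torsion_free: "x \<in> S \<Longrightarrow> lie_bracket X Y x = cov x (X x) Y - cov x (Y x) X"
  by (simp add: lie_bracket_def cov_def christoffel_commute)

lemma metricity:
  assumes "x \<in> S" "smooth_on S Y" "smooth_on S Z"
  shows "frechet_derivative (\<lambda>y. G y (Y y) (Z y)) (at x) w = G x (cov x w Y) (Z x) + G x (Y x) (cov x w Z)"
proof -
  have "frechet_derivative (\<lambda>y. G y (Y y) (Z y)) (at x) w =
      frechet_derivative (\<lambda>y. G y (Y x) (Z y)) (at x) w + G x (frechet_derivative Y (at x) w) (Z x)"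
    by (rule frechet_derivative_linear_family[OF open_S assms(1), of "\<lambda>y v. G y v (Z y)"])
      (auto intro!: linearI smooth_intros open_S assms)
  also have "frechet_derivative (\<lambda>y. G y (Y x) (Z y)) (at x) w =
      frechet_derivative (\<lambda>y. G y (Y x) (Z x)) (at x) w + G x (Y x) (frechet_derivative Z (at x) w)"
    by (rule frechet_derivative_linear_family[OF open_S assms(1), of "\<lambda>y v. G y (Y x) v"])
      (auto intro!: linearI smooth_intros open_S assms)
  finally show ?thesis
    using assms(1) by (simp add: cov_def christoffel_metric[OF metric open_S])
qed

end


section \<open>Curvature\<close>

text \<open>
  Polarisation.  With the symmetry under exchange of the two pairs, vanishing on \<open>(u,v,u,v)\<close> makes
  \<open>F\<close> change sign under every transposition of its arguments; the three terms of the Bianchi identity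
  then coincide.
\<close>

lemma curvature_like_eq_0:
  fixes F :: "'e::real_vector \<Rightarrow> 'e \<Rightarrow> 'e \<Rightarrow> 'e \<Rightarrow> real"
  assumes add1: "\<And>a b v w z. F (a + b) v w z = F a v w z + F b v w z"
    and add3: "\<And>u v a b z. F u v (a + b) z = F u v a z + F u v b z"
    and skew12: "\<And>u v w z. F u v w z = - F v u w z"
    and skew34: "\<And>u v w z. F u v w z = - F u v z w"
    and bianchi: "\<And>u v w z. F u v w z + F v w u z + F w u v z = 0"
    and sect: "\<And>u v. F u v u v = 0"
  shows "F u v w z = 0"
proof -
  have add2: "F u (a + b) w z = F u a w z + F u b w z" for u a b w z
    using add1[of a b u w z] skew12[of u "a + b" w z] skew12[of u a w z] skew12[of u b w z] by simp
  have add4: "F u v w (a + b) = F u v w a + F u v w b" for u v w a b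
    using add3[of u v a b w] skew34[of u v w "a + b"] skew34[of u v w a] skew34[of u v w b] by simp
  have pair: "F u v w z = F w z u v" for u v w z
    using bianchi[of u v w z] bianchi[of v w z u] bianchi[of w z u v] bianchi[of z u v w]
      skew34[of v w z u] skew34[of w z v u] skew12[of z v w u] skew34[of v z w u]
      skew34[of z u w v] skew12[of u w z v] skew34[of w u z v] skew34[of u v z w]
    by linarith
  have "F u v w v = 0" for u v w
    using sect[of "u + w" v] sect[of u v] sect[of w v] pair[of u v w v]
    by (simp add: add1 add3)
  note * = this
  have skew24: "F u v w z = - F u z w v" for u v w z
    using *[of u "v + z" w] *[of u v w] *[of u z w] by (simp add: add2 add4)
  have skew13: "F u v w z = - F w v u z" for u v w z
    using pair[of u v w z] skew24[of w z u v] by simp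
  show ?thesis
    using bianchi[of u v w z] skew13[of v w u z] skew12[of u w v z] skew13[of w u v z]
      skew12[of v u w z] by linarith
qed

context riemannian_domain begin

lemma cov_add:
  assumes "x \<in> S" "smooth_on S Y" "smooth_on S Z"
  shows "cov x w (\<lambda>y. Y y + Z y) = cov x w Y + cov x w Z"
  using frechet_derivative_at[OF has_derivative_add[OF smooth_on_has_derivative[OF assms(2,1)]
      smooth_on_has_derivative[OF assms(3,1)]]] assms(1)
  by (simp add: cov_def fun_eq_iff)

lemma cov_scaleR:
  assumes "x \<in> S" "smooth_on S Y"
  shows "cov x w (\<lambda>y. r *\<^sub>R Y y) = r *\<^sub>R cov x w Y"
  using frechet_derivative_at[OF has_derivative_scaleR_right[OF smooth_on_has_derivative[OF assms(2,1)]]] assms(1)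
  by (simp add: cov_def fun_eq_iff scaleR_add_right)

text \<open>
  The curvature $R(u,v)w$, evaluated on constant fields; their bracket vanishes.
\<close>

definition Rm :: "'e \<Rightarrow> 'e \<Rightarrow> 'e \<Rightarrow> 'e \<Rightarrow> 'e"
  where "Rm x u v w = cov x u (\<lambda>y. christoffel G y v w) - cov x v (\<lambda>y. christoffel G y u w)"

lemma riem_Rm: "x \<in> S \<Longrightarrow> riem G x u v w z = - G x (Rm x u v w) z"
proof -
  have "levi_civita G (\<lambda>_. u) (\<lambda>_. w) = (\<lambda>y. christoffel G y u w)" for u w
    by (simp add: fun_eq_iff levi_civita_cov cov_const)
  then show "x \<in> S \<Longrightarrow> ?thesis"
    by (simp add: riem_def curvature_def levi_civita_cov cov_const Rm_def lie_bracket_def)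
qed

lemma Rm_skew: "Rm x u v w = - Rm x v u w"
  by (simp add: Rm_def)

lemma Rm_bianchi:
  assumes "x \<in> S" shows "Rm x u v w + Rm x v w u + Rm x w u v = 0"
proof -
  have "cov x u (\<lambda>y. christoffel G y v w) = cov x u (\<lambda>y. christoffel G y w v)" for u v w
    by (rule cov_cong[OF assms christoffel_commute])
  then show ?thesis unfolding Rm_def by (metis (no_types, lifting) add.commute add_diff_cancel_left' diff_add_cancel add_diff_eq diff_self)
qed

lemma smooth_christoffel_const [smooth_intros]: "smooth_on S (\<lambda>y. christoffel G y u v)"
  by (intro smooth_intros open_S)

lemma Rm_add:
  assumes "x \<in> S"
  shows "Rm x (u + u') v w = Rm x u v w + Rm x u' v w"
    and "Rm x u v (w + w') = Rm x u v w + Rm x u v w'"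
proof -
  have 1: "cov x v (\<lambda>y. christoffel G y (u + u') w) =
      cov x v (\<lambda>y. christoffel G y u w) + cov x v (\<lambda>y. christoffel G y u' w)" for v u u' w
    using cov_cong[OF assms, of "\<lambda>y. christoffel G y (u + u') w"
        "\<lambda>y. christoffel G y u w + christoffel G y u' w"]
      cov_add[OF assms smooth_christoffel_const smooth_christoffel_const, of v u w u' w] by simp
  have 2: "cov x v (\<lambda>y. christoffel G y w (u + u')) =
      cov x v (\<lambda>y. christoffel G y w u) + cov x v (\<lambda>y. christoffel G y w u')" for v u u' w
    using cov_cong[OF assms, of "\<lambda>y. christoffel G y w (u + u')"
        "\<lambda>y. christoffel G y w u + christoffel G y w u'"]
      cov_add[OF assms smooth_christoffel_const smooth_christoffel_const, of v w u w u'] by simp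
  show "Rm x (u + u') v w = Rm x u v w + Rm x u' v w"
    using linear_add[OF cov_linear[OF assms smooth_christoffel_const], of u u' v w] 1[of v u u' w]
    by (simp add: Rm_def)
  show "Rm x u v (w + w') = Rm x u v w + Rm x u v w'"
    by (simp add: Rm_def 2)
qed

lemma Rm_scaleR:
  assumes "x \<in> S" shows "Rm x (r *\<^sub>R u) v w = r *\<^sub>R Rm x u v w"
proof -
  have "cov x v (\<lambda>y. christoffel G y (r *\<^sub>R u) w) = r *\<^sub>R cov x v (\<lambda>y. christoffel G y u w)"
    using cov_cong[OF assms, of "\<lambda>y. christoffel G y (r *\<^sub>R u) w" "\<lambda>y. r *\<^sub>R christoffel G y u w"]
      cov_scaleR[OF assms smooth_christoffel_const, of v r u w] by simp
  then show ?thesis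
    using linear_cmul[OF cov_linear[OF assms smooth_christoffel_const], of r u v w]
    by (simp add: Rm_def scaleR_diff_right)
qed

text \<open>
  The second derivatives of the function $g(w,z)$ in the directions \<open>u\<close> and \<open>v\<close> commute; expanding
  both by metricity leaves exactly the two curvature terms.
\<close>

lemma Rm_skew_G:
  assumes "x \<in> S" shows "G x (Rm x u v w) z = - G x (Rm x u v z) w"
proof -
  have d2: "frechet_derivative (\<lambda>y. frechet_derivative (\<lambda>y. G y w z) (at y) v) (at x) u =
      G x (cov x u (\<lambda>y. christoffel G y v w)) z + G x (christoffel G x v w) (christoffel G x u z)
      + (G x (christoffel G x u w) (christoffel G x v z) + G x w (cov x u (\<lambda>y. christoffel G y v z)))" for u v
  proof -
    have "frechet_derivative (\<lambda>y. frechet_derivative (\<lambda>y. G y w z) (at y) v) (at x) u =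
        frechet_derivative (\<lambda>y. G y (christoffel G y v w) z + G y w (christoffel G y v z)) (at x) u"
      by (subst frechet_derivative_cong_open[OF open_S assms])
        (simp_all add: christoffel_metric[OF metric open_S])
    also have "\<dots> = frechet_derivative (\<lambda>y. G y (christoffel G y v w) z) (at x) u
        + frechet_derivative (\<lambda>y. G y w (christoffel G y v z)) (at x) u"
    proof -
      have "smooth_on S (\<lambda>y. G y (christoffel G y v w) z)" "smooth_on S (\<lambda>y. G y w (christoffel G y v z))"
        by (intro smooth_intros open_S)+
      from has_derivative_add[OF this[THEN smooth_on_has_derivative, OF assms]]
      show ?thesis by (simp add: frechet_derivative_at[symmetric])
    qed
    finally show ?thesis
      using metricity[OF assms smooth_christoffel_const smooth_on_const[OF open_S], of v w z u]
        metricity[OF assms smooth_on_const[OF open_S] smooth_christoffel_const, of w v z u]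
      by (simp add: cov_const)
  qed
  have "frechet_derivative (\<lambda>y. frechet_derivative (\<lambda>y. G y w z) (at y) v) (at x) u =
      frechet_derivative (\<lambda>y. frechet_derivative (\<lambda>y. G y w z) (at y) u) (at x) v"
    by (rule frechet_derivative_commute[OF open_S smooth_G_const assms])
  then show ?thesis
    using assms G_commute[OF assms] unfolding d2 by (simp add: Rm_def)
qed

text \<open>
  Tensoriality.  The derivatives of \<open>X\<close> and \<open>Y\<close> are absorbed by the bracket term, and the second
  derivatives of \<open>Z\<close> cancel by symmetry.  This permits evaluating the curvature on basic fields.
\<close>

lemma curvature_fields:
  assumes "x \<in> S" "smooth_on S X" "smooth_on S Y" "smooth_on S Z"
  shows "cov x (X x) (\<lambda>y. cov y (Y y) Z) - cov x (Y x) (\<lambda>y. cov y (X y) Z)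
    - cov x (lie_bracket X Y x) Z = Rm x (X x) (Y x) (Z x)"
proof -
  let ?d = "\<lambda>X. frechet_derivative X (at x)"
  let ?dd = "\<lambda>u v. frechet_derivative (\<lambda>y. frechet_derivative Z (at y) u) (at x) v"
  have dlin: "linear (frechet_derivative X (at y))" if "smooth_on S X" "y \<in> S" for y and X :: "'e \<Rightarrow> 'e"
    using smooth_on_has_derivative[OF that] has_derivative_linear by blast
  have expand: "cov x u (\<lambda>y. cov y (Y y) Z) = ?dd (Y x) u + ?d Z (?d Y u)
      + (frechet_derivative (\<lambda>y. christoffel G y (Y x) (Z x)) (at x) u
        + christoffel G x (?d Y u) (Z x) + christoffel G x (Y x) (?d Z u))
      + (christoffel G x u (?d Z (Y x)) + christoffel G x u (christoffel G x (Y x) (Z x)))"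
    if Y: "smooth_on S Y" for u Y
  proof -
    have 1: "frechet_derivative (\<lambda>y. frechet_derivative Z (at y) (Y y)) (at x) u =
        ?dd (Y x) u + ?d Z (?d Y u)"
      by (rule frechet_derivative_linear_family[OF open_S assms(1), of "\<lambda>y. frechet_derivative Z (at y)"])
        (intro dlin assms Y smooth_on_frechet smooth_intros open_S | assumption)+
    have 2: "frechet_derivative (\<lambda>y. christoffel G y (Y y) (Z y)) (at x) u =
        frechet_derivative (\<lambda>y. christoffel G y (Y x) (Z y)) (at x) u + christoffel G x (?d Y u) (Z x)"
      by (rule frechet_derivative_linear_family[OF open_S assms(1), of "\<lambda>y v. christoffel G y v (Z y)"])
        (auto intro!: linearI smooth_intros open_S assms Y)
    have 3: "frechet_derivative (\<lambda>y. christoffel G y (Y x) (Z y)) (at x) u =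
        frechet_derivative (\<lambda>y. christoffel G y (Y x) (Z x)) (at x) u + christoffel G x (Y x) (?d Z u)"
      by (rule frechet_derivative_linear_family[OF open_S assms(1), of "\<lambda>y. christoffel G y (Y x)"])
        (auto intro!: linearI smooth_intros open_S assms Y)
    have "smooth_on S (\<lambda>y. frechet_derivative Z (at y) (Y y))" "smooth_on S (\<lambda>y. christoffel G y (Y y) (Z y))"
      by (intro smooth_on_frechet smooth_intros assms Y open_S)+
    from has_derivative_add[OF this[THEN smooth_on_has_derivative, OF assms(1)]]
    have "frechet_derivative (\<lambda>y. cov y (Y y) Z) (at x) u =
        frechet_derivative (\<lambda>y. frechet_derivative Z (at y) (Y y)) (at x) u
        + frechet_derivative (\<lambda>y. christoffel G y (Y y) (Z y)) (at x) u"
      unfolding cov_def by (simp add: frechet_derivative_at[symmetric])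
    then show ?thesis
      using assms(1) unfolding cov_def[of x u] unfolding cov_def by (simp add: 1 2 3)
  qed
  have "?dd (X x) (Y x) = ?dd (Y x) (X x)"
    by (rule frechet_derivative_commute_vector[OF open_S assms(4,1)])
  then show ?thesis
    using assms(1) linear_diff[OF dlin[OF assms(4,1)]]
    unfolding expand[OF assms(2)] expand[OF assms(3)] Rm_def cov_def[of x "lie_bracket X Y x"]
    by (simp add: cov_def lie_bracket_def)
qed

end

locale constant_curvature_domain = riemannian_domain +
  fixes c :: real
  assumes sectional: "\<And>x u v. x \<in> S \<Longrightarrow> u \<noteq> v \<Longrightarrow> independent {u, v} \<Longrightarrow> sectional_curvature G x u v = c"
begin

text \<open>
  The difference of the two sides has the symmetries of a curvature tensor and no sectional
  curvature.
\<close>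

lemma Rm_constant:
  assumes x: "x \<in> S"
  shows "G x (Rm x u v w) z = c * (G x v w * G x u z - G x u w * G x v z)"
proof -
  have Rm_self: "Rm x v v w = 0" for v w by (simp add: Rm_def)
  have sect: "G x (Rm x u v u) v = c * (G x v u * G x u v - G x u u * G x v v)" for u v
  proof (cases "v = 0 \<or> (\<exists>r. u = r *\<^sub>R v)")
    case True
    then show ?thesis
    proof
      assume "v = 0"
      then show ?thesis using x by simp
    next
      assume "\<exists>r. u = r *\<^sub>R v"
      then obtain r where "u = r *\<^sub>R v" by blast
      then show ?thesis using x by (simp add: Rm_scaleR Rm_self)
    qed
  next
    case False
    then have uv: "u \<notin> span {v}" "v \<noteq> 0" "u \<noteq> v"
      by (auto simp: span_singleton) (metis scaleR_one)
    then have "independent {u, v}" by (simp add: independent_insert)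
    from sectional[OF x uv(3) this]
    have "riem G x u v u v / (G x u u * G x v v - (G x u v)\<^sup>2) = c"
      by (simp add: sectional_curvature_def)
    moreover have "G x u u * G x v v - (G x u v)\<^sup>2 \<noteq> 0"
    proof -
      define w where "w = u - (G x u v / G x v v) *\<^sub>R v"
      have "w \<noteq> 0" using False by (auto simp: w_def)
      then have "G x w w > 0" by (rule G_pos[OF x])
      moreover have "G x w w * G x v v = G x u u * G x v v - (G x u v)\<^sup>2"
        using G_pos[OF x uv(2)] x
        by (simp add: w_def G_commute[OF x, of v u] field_simps power2_eq_square)
      ultimately show ?thesis using G_pos[OF x uv(2)] by (metis mult_pos_pos less_irrefl)
    qed
    ultimately show ?thesis
      using x by (simp add: riem_Rm field_simps power2_eq_square G_commute[OF x, of v u])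
  qed
  define F where "F u v w z = G x (Rm x u v w) z - c * (G x v w * G x u z - G x u w * G x v z)" for u v w z
  have "F u v w z = 0"
  proof (rule curvature_like_eq_0[of F])
    show "F (a + b) v w z = F a v w z + F b v w z" for a b v w z
      using x by (simp add: F_def Rm_add algebra_simps)
    show "F u v (a + b) z = F u v a z + F u v b z" for u v a b z
      using x by (simp add: F_def Rm_add algebra_simps)
    show "F u v w z = - F v u w z" for u v w z
      using x Rm_skew[of x u v w] by (simp add: F_def algebra_simps)
    show "F u v w z = - F u v z w" for u v w z
      using x Rm_skew_G[OF x, of u v w z] by (simp add: F_def algebra_simps)
    show "F u v w z + F v w u z + F w u v z = 0" for u v w z
    proof -
      have "G x (Rm x u v w) z + G x (Rm x v w u) z + G x (Rm x w u v) z = 0"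
        using arg_cong[OF Rm_bianchi[OF x, of u v w], of "\<lambda>a. G x a z"] x by simp
      moreover have "G x v w = G x w v" "G x u w = G x w u" "G x u v = G x v u"
        using G_commute[OF x] by blast+
      ultimately show ?thesis by (simp add: F_def algebra_simps)
    qed
    show "F u v u v = 0" for u v using sect by (simp add: F_def)
  qed
  then show ?thesis by (simp add: F_def)
qed

lemma curvature_fields_constant:
  assumes "x \<in> S" "smooth_on S X" "smooth_on S Y" "smooth_on S Z"
  shows "G x (cov x (X x) (\<lambda>y. cov y (Y y) Z)) w - G x (cov x (Y x) (\<lambda>y. cov y (X y) Z)) w
    - G x (cov x (lie_bracket X Y x) Z) w
    = c * (G x (Y x) (Z x) * G x (X x) w - G x (X x) (Z x) * G x (Y x) w)"
  using arg_cong[OF curvature_fields[OF assms], of "\<lambda>a. G x a w"] Rm_constant[OF assms(1)] assms(1)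
  by simp

end


section \<open>Foliated domains\<close>

lemma vertical_iff: "u \<in> vertical_space \<longleftrightarrow> snd u = 0"
  by (simp add: vertical_space_def)

lemma subspace_vertical: "subspace vertical_space"
  by (auto simp: subspace_def vertical_space_def)

locale foliated_domain = riemannian_domain S G
  for S :: "('v::euclidean_space \<times> 'h::euclidean_space) set" and G
begin

lemma horizontal_iff: "u \<in> horizontal_space G x \<longleftrightarrow> (\<forall>v. snd v = 0 \<longrightarrow> G x u v = 0)"
  by (auto simp: horizontal_space_def vertical_iff)

lemma subspace_horizontal: "x \<in> S \<Longrightarrow> subspace (horizontal_space G x)"
  by (auto simp: subspace_def horizontal_iff)

lemma orthonormal_basis_exists:
  assumes x: "x \<in> S" and W: "subspace W"
  shows "\<exists>B. orthonormal_basis (G x) W B"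
proof -
  obtain B where B: "B \<subseteq> W" "independent B" "W \<subseteq> span B" using basis_exists[of W] by metis
  have fin: "finite B" using independent_bound B(2) by blast
  then obtain E where E: "smooth_frame B E" using smooth_frame_exists B(2) by blast
  have sp: "span ((\<lambda>b. E b x) ` B) = W"
    using E x B span_minimal[OF B(1) W] by (auto simp: smooth_frame_def)
  have on: "G x (E a x) (E b x) = (if a = b then 1 else 0)" if "a \<in> B" "b \<in> B" for a b
    using E x that by (auto simp: smooth_frame_def)
  have "orthonormal_basis (G x) W ((\<lambda>b. E b x) ` B)"
    unfolding orthonormal_basis_def
  proof (intro conjI ballI)
    show "(\<lambda>b. E b x) ` B \<subseteq> W" unfolding sp[symmetric] by (rule span_superset)
    fix a b assume "a \<in> (\<lambda>b. E b x) ` B" "b \<in> (\<lambda>b. E b x) ` B"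
    then obtain a' b' where ab: "a = E a' x" "b = E b' x" "a' \<in> B" "b' \<in> B" by blast
    show "G x a b = (if a = b then 1 else 0)"
      using on[OF ab(3,4)] on[OF ab(3,3)] by (cases "a' = b'") (auto simp: ab(1,2))
  qed (use fin sp in auto)
  then show ?thesis by blast
qed

lemma orthonormal_basis_parseval:
  assumes "x \<in> S" "orthonormal_basis (G x) W B" "u \<in> W"
  shows "G x u w = (\<Sum>b\<in>B. G x u b * G x b w)"
  using assms orthonormal_expansion_G[of x B "\<lambda>b. b" u w] by (simp add: orthonormal_basis_def)

lemma orthonormal_basis_norm:
  assumes "x \<in> S" "orthonormal_basis (G x) W B" "u \<in> W"
  shows "G x u u = (\<Sum>b\<in>B. (G x u b)\<^sup>2)"
  unfolding orthonormal_basis_parseval[OF assms, of u] power2_eq_square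
  by (intro sum.cong refl) (simp add: G_commute[OF assms(1), of _ u])

text \<open>
  A single choice for the whole domain, so that the projections defined pointwise by orthogonality
  acquire an explicit smooth formula.
\<close>

definition vertical_frame :: "'v \<times> 'h \<Rightarrow> 'v \<times> 'h \<Rightarrow> 'v \<times> 'h"
  where "vertical_frame = (SOME E. smooth_frame ((\<lambda>b. (b, 0)) ` Basis) E)"

abbreviation (input) vindex :: "('v \<times> 'h) set"
  where "vindex \<equiv> (\<lambda>b. (b, 0)) ` Basis"

lemma span_vindex: "span vindex = (vertical_space :: ('v \<times> 'h) set)"
proof -
  have lin: "linear (\<lambda>b::'v. (b, 0::'h))" by (auto intro!: linearI)
  show ?thesis
    unfolding linear_span_image[OF lin] span_Basis by (auto simp: vertical_space_def)
qed

lemma smooth_vertical_frame: "smooth_frame vindex vertical_frame"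
proof -
  have lin: "linear (\<lambda>b::'v. (b, 0::'h))" by (auto intro!: linearI)
  have "independent vindex"
    by (rule linear_independent_injective_image[OF lin independent_Basis]) (simp add: inj_on_def)
  then show ?thesis
    unfolding vertical_frame_def by (intro someI_ex[OF smooth_frame_exists]) auto
qed

lemma vproj_frame:
  assumes x: "x \<in> S"
  shows "vproj G x u = (\<Sum>b\<in>vindex. G x u (vertical_frame b x) *\<^sub>R vertical_frame b x)" (is "_ = ?p")
proof -
  note F = smooth_vertical_frame[unfolded smooth_frame_def]
  have on: "G x (vertical_frame a x) (vertical_frame b x) = (if a = b then 1 else 0)"
    if "a \<in> vindex" "b \<in> vindex" for a b
    using F x that by blast
  have sp: "span ((\<lambda>b. vertical_frame b x) ` vindex) = vertical_space"
    using F x span_vindex by metis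
  have p: "?p \<in> vertical_space"
    unfolding sp[symmetric] by (intro span_sum span_scale span_base) auto
  have h: "u - ?p \<in> horizontal_space G x"
    unfolding horizontal_space_def
  proof (intro CollectI ballI)
    fix v assume "v \<in> (vertical_space :: ('v \<times> 'h) set)"
    then have "v \<in> span ((\<lambda>b. vertical_frame b x) ` vindex)" using sp by simp
    from orthonormal_expansion_G[OF x _ on this, of u]
    have "G x v u = G x v ?p" using x by (simp add: G_sum G_commute[OF x, of u] mult.commute)
    then show "G x (u - ?p) v = 0" using G_commute[OF x] x by simp
  qed
  show ?thesis
    unfolding vproj_def
  proof (rule the_equality)
    fix w assume w: "w \<in> vertical_space \<and> u - w \<in> horizontal_space G x"
    have "(u - w) - (u - ?p) \<in> horizontal_space G x"
      using w h subspace_diff[OF subspace_horizontal[OF x]] by blast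
    moreover have "?p - w \<in> vertical_space"
      using w p subspace_diff[OF subspace_vertical] by blast
    ultimately have "G x (?p - w) (?p - w) = 0" by (auto simp: horizontal_space_def)
    then have "?p - w = 0" using G_eq_0_iff[OF x] by blast
    then show "w = ?p" by (rule eq_iff_diff_eq_0[THEN iffD2, symmetric])
  qed (use p h in simp)
qed

lemma
  assumes "x \<in> S"
  shows snd_vproj: "snd (vproj G x u) = 0"
    and hproj_orth: "snd w = 0 \<Longrightarrow> G x (hproj G x u) w = 0"
proof -
  note F = smooth_vertical_frame[unfolded smooth_frame_def]
  have on: "G x (vertical_frame a x) (vertical_frame b x) = (if a = b then 1 else 0)"
    if "a \<in> vindex" "b \<in> vindex" for a b
    using F assms that by blast
  have sp: "span ((\<lambda>b. vertical_frame b x) ` vindex) = vertical_space"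
    using F assms span_vindex by metis
  have p: "vproj G x u \<in> vertical_space"
    unfolding sp[symmetric] vproj_frame[OF assms] by (intro span_sum span_scale span_base) auto
  then show "snd (vproj G x u) = 0" by (simp add: vertical_iff)
  assume "snd w = 0"
  then have "w \<in> span ((\<lambda>b. vertical_frame b x) ` vindex)" using sp by (simp add: vertical_iff)
  from orthonormal_expansion_G[OF assms _ on this, of u]
  have "G x w u = G x w (vproj G x u)"
    unfolding vproj_frame[OF assms] using assms by (simp add: G_sum G_commute[OF assms, of u] mult.commute)
  then show "G x (hproj G x u) w = 0" using G_commute[OF assms] assms by (simp add: hproj_def)
qed

lemma hproj_orth': "x \<in> S \<Longrightarrow> snd w = 0 \<Longrightarrow> G x w (hproj G x u) = 0"
  using hproj_orth G_commute by metis

lemma snd_hproj [simp]: "x \<in> S \<Longrightarrow> snd (hproj G x u) = snd u"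
  by (simp add: hproj_def snd_vproj)

lemma hproj_horizontal: "x \<in> S \<Longrightarrow> hproj G x u \<in> horizontal_space G x"
  by (simp add: horizontal_iff hproj_orth)

lemma hproj_eq_0: assumes "x \<in> S" "snd u = 0" shows "hproj G x u = 0"
  using hproj_orth[OF assms(1), of "hproj G x u" u] G_eq_0_iff[OF assms(1)] assms by simp

lemma vproj_add: "x \<in> S \<Longrightarrow> vproj G x (u + v) = vproj G x u + vproj G x v"
  by (simp add: vproj_frame scaleR_add_left sum.distrib)

lemma vproj_scaleR: "x \<in> S \<Longrightarrow> vproj G x (r *\<^sub>R u) = r *\<^sub>R vproj G x u"
  by (simp add: vproj_frame scaleR_sum_right)

lemma hproj_add: "x \<in> S \<Longrightarrow> hproj G x (u + v) = hproj G x u + hproj G x v"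
  by (simp add: hproj_def vproj_add)

lemma hproj_scaleR: "x \<in> S \<Longrightarrow> hproj G x (r *\<^sub>R u) = r *\<^sub>R hproj G x u"
  by (simp add: hproj_def vproj_scaleR scaleR_diff_right)

lemma hproj_diff: "x \<in> S \<Longrightarrow> hproj G x (u - v) = hproj G x u - hproj G x v"
  using hproj_add[of x u "-1 *\<^sub>R v"] hproj_scaleR[of x "-1" v] by simp

lemma hproj_cong_vertical:
  assumes "x \<in> S" "snd (u - v) = 0" shows "hproj G x u = hproj G x v"
  using hproj_eq_0[OF assms] hproj_diff[OF assms(1), of u v] by simp

lemma hproj_id:
  assumes "x \<in> S" "u \<in> horizontal_space G x" shows "hproj G x u = u"
proof -
  have "u - hproj G x u \<in> horizontal_space G x"
    using assms hproj_horizontal subspace_diff[OF subspace_horizontal] by blast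
  moreover have "snd (u - hproj G x u) = 0" using assms(1) by simp
  ultimately have "G x (u - hproj G x u) (u - hproj G x u) = 0"
    unfolding horizontal_iff by blast
  then show ?thesis using G_eq_0_iff[OF assms(1)] by fastforce
qed

lemma vproj_eq: "vproj G x u = u - hproj G x u"
  by (simp add: hproj_def)

text \<open>Against a horizontal vector only the horizontal part counts, and likewise vertically.\<close>

lemma G_hproj:
  assumes "x \<in> S" "w \<in> horizontal_space G x"
  shows "G x (hproj G x u) w = G x u w" "G x w (hproj G x u) = G x w u"
proof -
  have "G x w (vproj G x u) = 0" using assms(2) snd_vproj[OF assms(1), of u] unfolding horizontal_iff by blast
  then show "G x (hproj G x u) w = G x u w" "G x w (hproj G x u) = G x w u"
    using assms G_commute[OF assms(1)] by (simp_all add: hproj_def)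
qed

lemma G_vproj:
  assumes "x \<in> S" "snd w = 0"
  shows "G x (vproj G x u) w = G x u w" "G x w (vproj G x u) = G x w u"
  using assms by (simp_all add: vproj_eq hproj_orth hproj_orth')

lemma G_split:
  assumes "x \<in> S"
  shows "G x u w = G x (hproj G x u) w + G x (vproj G x u) w"
  using assms by (simp add: hproj_def)

lemma vertical_eqI:
  assumes "x \<in> S" "snd u = 0" "snd u' = 0" "\<And>w. snd w = 0 \<Longrightarrow> G x u w = G x u' w"
  shows "u = u'"
  using G_eq_0_iff[OF assms(1), of "u - u'"] assms(4)[of "u - u'"] assms(1-3) by simp

lemma smooth_on_vproj [smooth_intros]: "smooth_on S X \<Longrightarrow> smooth_on S (\<lambda>x. vproj G x (X x))"
proof (rule smooth_on_cong[OF open_S])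
  assume X: "smooth_on S X"
  note F = smooth_vertical_frame[unfolded smooth_frame_def]
  have "smooth_on S (vertical_frame b)" if "b \<in> vindex" for b
    using F that by blast
  then show "smooth_on S (\<lambda>x. \<Sum>b\<in>vindex. G x (X x) (vertical_frame b x) *\<^sub>R vertical_frame b x)"
    by (intro smooth_intros open_S X)
qed (simp add: vproj_frame)

lemma smooth_on_hproj [smooth_intros]: "smooth_on S X \<Longrightarrow> smooth_on S (\<lambda>x. hproj G x (X x))"
  unfolding hproj_def by (intro smooth_intros open_S)

subsection \<open>Horizontal lifts\<close>

text \<open>
  As \<open>u\<close> is a constant vector, this is the basic field that lifts the constant field \<open>snd u\<close> of the
  local quotient.  Every horizontal vector is the value of such a field.
\<close>

definition hlift :: "'v \<times> 'h \<Rightarrow> 'v \<times> 'h \<Rightarrow> 'v \<times> 'h"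
  where "hlift u y = hproj G y u"

lemma smooth_hlift [smooth_intros]: "smooth_on S (hlift u)"
  using smooth_on_hproj[OF smooth_on_const[OF open_S, of u]] by (simp add: hlift_def[abs_def])

lemma snd_hlift [simp]: "x \<in> S \<Longrightarrow> snd (hlift u x) = snd u"
  by (simp add: hlift_def)

lemma hlift_horizontal: "x \<in> S \<Longrightarrow> hlift u x \<in> horizontal_space G x"
  by (simp add: hlift_def hproj_horizontal)

lemma hlift_id: "x \<in> S \<Longrightarrow> u \<in> horizontal_space G x \<Longrightarrow> hlift u x = u"
  by (simp add: hlift_def hproj_id)

lemma hlift_orth: "x \<in> S \<Longrightarrow> snd v = 0 \<Longrightarrow> G x (hlift u x) v = 0"
  by (simp add: hlift_def hproj_orth)

lemma smooth_const [smooth_intros]: "smooth_on S (\<lambda>_. v)"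
  by (rule smooth_on_const[OF open_S])

text \<open>
  The projection of such a field to the quotient is constant, so its derivatives are vertical; hence
  all brackets among horizontal lifts and vertical fields are vertical.
\<close>

lemma snd_frechet_derivative:
  assumes "x \<in> S" "smooth_on S X" "\<And>y. y \<in> S \<Longrightarrow> snd (X y) = k"
  shows "snd (frechet_derivative X (at x) w) = 0"
proof -
  have "((\<lambda>y. snd (X y)) has_derivative (\<lambda>w. snd (frechet_derivative X (at x) w))) (at x)"
    by (rule bounded_linear.has_derivative[OF bounded_linear_snd smooth_on_has_derivative[OF assms(2,1)]])
  moreover have "((\<lambda>y. snd (X y)) has_derivative (\<lambda>w. 0)) (at x)"
    by (rule has_derivative_transform_within_open[OF has_derivative_const open_S assms(1)])
      (simp add: assms(3))
  ultimately show ?thesis using has_derivative_unique by metis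
qed

lemma snd_lie_bracket:
  assumes "x \<in> S" "smooth_on S X" "smooth_on S Y"
    "\<And>y. y \<in> S \<Longrightarrow> snd (X y) = k" "\<And>y. y \<in> S \<Longrightarrow> snd (Y y) = l"
  shows "snd (lie_bracket X Y x) = 0"
  using snd_frechet_derivative[OF assms(1,2,4)] snd_frechet_derivative[OF assms(1,3,5)]
  by (simp add: lie_bracket_def)

text \<open>
  The difference is the bracket of \<open>v\<close> with the lift.  Up to vertical terms, the derivative of a basic
  field in a vertical direction is thus tensorial in both arguments.
\<close>

lemma snd_cov_vertical_commute:
  assumes "x \<in> S" "snd v = 0"
  shows "snd (cov x v (hlift u) - christoffel G x (hlift u x) v) = 0"
  using snd_lie_bracket[where X = "\<lambda>_. v" and Y = "hlift u" and k = "snd v" and l = "snd u",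
      OF assms(1) smooth_const smooth_hlift] torsion_free[OF assms(1), of "\<lambda>_. v" "hlift u"] by (simp add: cov_const)

lemma snd_cov_commute:
  assumes "x \<in> S"
  shows "snd (cov x (hlift u x) (hlift w) - cov x (hlift w x) (hlift u)) = 0"
  using snd_lie_bracket[where X = "hlift u" and Y = "hlift w" and k = "snd u" and l = "snd w",
      OF assms smooth_hlift smooth_hlift] torsion_free[OF assms, of "hlift u" "hlift w"] by simp

text \<open>
  Obtained by differentiating the orthogonality of the lift to the constant vertical field \<open>v\<close>.
\<close>

lemma cov_hlift_vertical:
  assumes "x \<in> S" "snd v = 0"
  shows "G x (cov x w (hlift u)) v = - G x (hlift u x) (christoffel G x w v)"
proof -
  have "frechet_derivative (\<lambda>y. G y (hlift u y) v) (at x) w = frechet_derivative (\<lambda>y. 0) (at x) w"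
    by (subst frechet_derivative_cong_open[OF open_S assms(1)]) (simp_all add: hlift_orth assms(2))
  then show ?thesis
    using metricity[OF assms(1) smooth_hlift smooth_const, of u v w] by (simp add: cov_const)
qed

end

locale riemannian_foliation_domain = foliated_domain S G
  for S :: "('v::euclidean_space \<times> 'h::euclidean_space) set" and G +
  assumes bundle_like:
    "\<And>x u w. x \<in> S \<Longrightarrow> snd w = 0 \<Longrightarrow>
      frechet_derivative (\<lambda>y. G y (hlift u y) (hlift u y)) (at x) w = 0"
begin

text \<open>
  The derivative of the metric of the quotient along the leaves vanishes.  By polarisation and
  torsion-freeness this says that $g(D_X V, Y)$ is skew in basic fields \<open>X\<close>, \<open>Y\<close>.
\<close>

lemma christoffel_skew_hlift:
  assumes "x \<in> S" "snd v = 0"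
  shows "G x (christoffel G x (hlift u x) v) (hlift w x) = - G x (christoffel G x (hlift w x) v) (hlift u x)"
proof -
  have diag: "G x (cov x v (hlift u)) (hlift u x) = 0" for u
    using metricity[OF assms(1) smooth_hlift smooth_hlift, of u u v] bundle_like[OF assms, of u]
      G_commute[OF assms(1), of "hlift u x"] by simp
  have "hlift (u + w) y = hlift u y + hlift w y" if "y \<in> S" for y
    using that by (simp add: hlift_def hproj_add)
  moreover from this have "cov x v (hlift (u + w)) = cov x v (hlift u) + cov x v (hlift w)"
    using cov_cong[OF assms(1), of "hlift (u + w)" "\<lambda>y. hlift u y + hlift w y"]
      cov_add[OF assms(1) smooth_hlift smooth_hlift, of v u w] by simp
  ultimately have "G x (cov x v (hlift u)) (hlift w x) + G x (cov x v (hlift w)) (hlift u x) = 0"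
    using diag[of "u + w"] diag[of u] diag[of w] assms(1) by simp
  moreover have "G x (cov x v (hlift u)) (hlift w x) = G x (christoffel G x (hlift u x) v) (hlift w x)" for u w
    using hproj_cong_vertical[OF assms(1) snd_cov_vertical_commute[OF assms], of u]
      G_hproj(1)[OF assms(1) hlift_horizontal[OF assms(1)]] by metis
  ultimately show ?thesis by simp
qed

lemma christoffel_skew:
  assumes "x \<in> S" "snd v = 0" "u \<in> horizontal_space G x" "w \<in> horizontal_space G x"
  shows "G x (christoffel G x u v) w = - G x (christoffel G x w v) u"
  using christoffel_skew_hlift[OF assms(1,2), of u w] assms by (simp add: hlift_id)

text \<open>
  This is the skewness of $A_X Y$ in horizontal arguments.
\<close>

lemma cov_hlift_skew:
  assumes "x \<in> S" "snd v = 0"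
  shows "G x (cov x (hlift u x) (hlift w)) v = - G x (cov x (hlift w x) (hlift u)) v"
  using cov_hlift_vertical[OF assms] christoffel_skew_hlift[OF assms, of u w] G_commute[OF assms(1)]
  by metis

lemma cov_hlift_self_horizontal:
  assumes "x \<in> S" shows "cov x (hlift u x) (hlift u) \<in> horizontal_space G x"
  using cov_hlift_skew[OF assms, of _ u u] by (auto simp: horizontal_iff)

lemma vproj_cov_skew:
  assumes "x \<in> S"
  shows "vproj G x (cov x (hlift u x) (hlift w)) = - vproj G x (cov x (hlift w x) (hlift u))"
  using assms by (intro vertical_eqI[OF assms]) (simp_all add: snd_vproj G_vproj cov_hlift_skew[of x _ u w])

lemma hproj_cov_sym:
  assumes "x \<in> S"
  shows "hproj G x (cov x (hlift u x) (hlift w)) = hproj G x (cov x (hlift w x) (hlift u))"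
  by (rule hproj_cong_vertical[OF assms snd_cov_commute[OF assms]])

text \<open>
  For horizontal \<open>u\<close> and vertical \<open>v\<close> this is O'Neill's $A_u v$: the constant extension of \<open>v\<close> has
  no derivative, so only the Christoffel term remains.
\<close>

definition tensA :: "'v \<times> 'h \<Rightarrow> 'v \<times> 'h \<Rightarrow> 'v \<times> 'h \<Rightarrow> 'v \<times> 'h"
  where "tensA x u v = hproj G x (christoffel G x u v)"

end

text \<open>
  For vertical \<open>u\<close> and \<open>v\<close> the horizontal part of the Christoffel term is $T_u v$, and \<open>N\<close> stands for
  the mean curvature field divided by the leaf dimension.
\<close>

locale umbilic_foliation_domain = riemannian_foliation_domain S G + constant_curvature_domain S G c
  for S :: "('v::euclidean_space \<times> 'h::euclidean_space) set" and G c +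
  fixes N :: "'v \<times> 'h \<Rightarrow> 'v \<times> 'h"
  assumes umbilic: "\<And>x u v. x \<in> S \<Longrightarrow> snd u = 0 \<Longrightarrow> snd v = 0 \<Longrightarrow>
      hproj G x (christoffel G x u v) = G x u v *\<^sub>R N x"
begin

lemma vertical_nonzero_exists: "\<exists>v::'v \<times> 'h. snd v = 0 \<and> v \<noteq> 0"
proof -
  obtain b :: 'v where "b \<in> Basis" using nonempty_Basis by blast
  then show ?thesis by (intro exI[of _ "(b, 0)"]) (auto simp: zero_prod_def)
qed

lemma N_eq:
  assumes "x \<in> S" "snd v = 0" "v \<noteq> 0"
  shows "N x = (1 / G x v v) *\<^sub>R hproj G x (christoffel G x v v)"
  using umbilic[OF assms(1,2,2)] G_pos[OF assms(1,3)] by simp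

lemma N_horizontal: assumes "x \<in> S" shows "N x \<in> horizontal_space G x"
proof -
  obtain v :: "'v \<times> 'h" where "snd v = 0" "v \<noteq> 0" using vertical_nonzero_exists by blast
  from N_eq[OF assms this] show ?thesis
    using subspace_scale[OF subspace_horizontal[OF assms] hproj_horizontal[OF assms]] by simp
qed

lemma smooth_N [smooth_intros]: "smooth_on S N"
proof -
  obtain v :: "'v \<times> 'h" where v: "snd v = 0" "v \<noteq> 0" using vertical_nonzero_exists by blast
  show ?thesis
  proof (rule smooth_on_cong[OF open_S N_eq[symmetric]])
    show "smooth_on S (\<lambda>x. (1 / G x v v) *\<^sub>R hproj G x (christoffel G x v v))"
      by (intro smooth_intros open_S G_pos v)
  qed (use v in auto)
qed

lemma G_christoffel_vertical:
  assumes "x \<in> S" "snd v = 0" "snd v' = 0" "w \<in> horizontal_space G x"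
  shows "G x (christoffel G x v v') w = G x v v' * G x (N x) w"
  using G_hproj(1)[OF assms(1,4), of "christoffel G x v v'"] umbilic[OF assms(1,2,3)] assms(1) by simp

text \<open>
  The horizontal part is $A_X V$ because $[V,X]$ is vertical, the vertical part is the shape operator
  of the umbilical leaf.
\<close>

lemma cov_vertical_hlift:
  assumes x: "x \<in> S" and v: "snd v = 0"
  shows "cov x v (hlift u) = tensA x (hlift u x) v - G x (N x) (hlift u x) *\<^sub>R v"
proof -
  have "hproj G x (cov x v (hlift u)) = tensA x (hlift u x) v"
    unfolding tensA_def by (rule hproj_cong_vertical[OF x snd_cov_vertical_commute[OF x v]])
  moreover have "vproj G x (cov x v (hlift u)) = - (G x (N x) (hlift u x) *\<^sub>R v)"
  proof (rule vertical_eqI[OF x])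
    fix w :: "'v \<times> 'h" assume w: "snd w = 0"
    show "G x (vproj G x (cov x v (hlift u))) w = G x (- (G x (N x) (hlift u x) *\<^sub>R v)) w"
      using G_christoffel_vertical[OF x v w hlift_horizontal[OF x], of u]
        cov_hlift_vertical[OF x w, of v u] G_commute[OF x, of "hlift u x"] w x
      by (simp add: G_vproj)
  qed (use x v in \<open>simp_all add: snd_vproj\<close>)
  ultimately show ?thesis by (simp add: hproj_def algebra_simps)
qed

text \<open>
  The mixed curvature equation reads $c = g(D_X N, X) + |A_X V|^2 - g(N,X)^2$ for unit vectors \<open>X\<close>,
  \<open>V\<close>; the middle term is the only one that involves \<open>V\<close>.
\<close>

lemma tensA_conformal_vertical:
  assumes x: "x \<in> S" and u: "u \<in> horizontal_space G x"
  shows "\<exists>\<phi>. \<forall>v. snd v = 0 \<longrightarrow> G x (tensA x u v) (tensA x u v) = \<phi> * G x v v"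
proof -
  let ?X = "hlift u"
  have Xx: "?X x = u" by (rule hlift_id[OF x u])
  define n where "n y = G y (N y) (?X y)" for y
  have n_smooth: "smooth_on S n" unfolding n_def by (intro smooth_intros)
  define dn where "dn = frechet_derivative n (at x) u"
  have "G x (tensA x u v) (tensA x u v) =
      (c * G x u u - dn + G x (N x) (cov x u ?X) + (n x)\<^sup>2) * G x v v" if v: "snd v = 0" for v
  proof -
    have h: "cov x u ?X \<in> horizontal_space G x"
      using cov_hlift_self_horizontal[OF x, of u] Xx by simp
    have "frechet_derivative (\<lambda>y. G y (christoffel G y v v) (?X y)) (at x) u =
        frechet_derivative (\<lambda>y. G y v v * n y) (at x) u"
      unfolding n_def
      by (rule fun_cong, rule frechet_derivative_cong_open[OF open_S x])
        (rule G_christoffel_vertical[OF _ v v hlift_horizontal])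
    also have "\<dots> = G x v v * dn + frechet_derivative (\<lambda>y. G y v v) (at x) u * n x"
      unfolding dn_def
      by (rule fun_cong[OF frechet_derivative_at[OF has_derivative_mult[OF
            smooth_on_has_derivative[OF smooth_G_const x] smooth_on_has_derivative[OF n_smooth x]]], symmetric])
    also have "frechet_derivative (\<lambda>y. G y v v) (at x) u = 2 * G x (christoffel G x u v) v"
      using metricity[OF x smooth_const smooth_const, of v v u] G_commute[OF x, of v] by (simp add: cov_const)
    finally have t1: "G x (cov x u (\<lambda>y. christoffel G y v v)) u =
        G x v v * dn + 2 * G x (christoffel G x u v) v * n x - G x v v * G x (N x) (cov x u ?X)"
      using metricity[OF x smooth_christoffel_const smooth_hlift, of v v u u]
        G_christoffel_vertical[OF x v v h] Xx by simp
    have "frechet_derivative (\<lambda>y. G y (christoffel G y (?X y) v) (?X y)) (at x) v =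
        frechet_derivative (\<lambda>y. 0) (at x) v"
      by (rule fun_cong, rule frechet_derivative_cong_open[OF open_S x])
        (use christoffel_skew_hlift[OF _ v, of _ u u] in auto)
    moreover have "smooth_on S (\<lambda>y. christoffel G y (?X y) v)" by (intro smooth_intros)
    ultimately have t2: "G x (cov x v (\<lambda>y. christoffel G y (?X y) v)) u =
        - G x (christoffel G x u v) (cov x v ?X)"
      using metricity[OF x _ smooth_hlift, of "\<lambda>y. christoffel G y (?X y) v" u v] Xx by simp
    have cv: "cov x v ?X = tensA x u v - n x *\<^sub>R v"
      using cov_vertical_hlift[OF x v, of u] Xx by (simp add: n_def)
    have aa: "G x (christoffel G x u v) (tensA x u v) = G x (tensA x u v) (tensA x u v)"
      using G_hproj(1)[OF x hproj_horizontal[OF x]] by (simp add: tensA_def)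
    have va: "G x (tensA x u v) v = 0"
      by (simp add: tensA_def hproj_orth[OF x v])
    let ?L = "lie_bracket ?X (\<lambda>_. v) x"
    have L: "snd ?L = 0"
      by (rule snd_lie_bracket[where k = "snd u" and l = "snd v", OF x smooth_hlift smooth_const]) simp_all
    have "?L = christoffel G x u v - cov x v ?X"
      using torsion_free[OF x, of ?X "\<lambda>_. v"] Xx by (simp add: cov_const)
    then have t3: "G x (christoffel G x ?L v) u = (G x (christoffel G x u v) v + n x * G x v v) * n x"
      using G_christoffel_vertical[OF x L v u] x va by (simp add: cv n_def Xx)
    have uv: "G x v u = 0" "G x u v = 0"
      using u v G_commute[OF x] unfolding horizontal_iff by metis+
    show ?thesis
      using curvature_fields_constant[OF x smooth_hlift smooth_const smooth_const, of u v v u]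
        t1 t2 t3 cv aa x uv Xx
      by (simp add: cov_const algebra_simps power2_eq_square)
  qed
  then show ?thesis by blast
qed

end


section \<open>The horizontal curvature equation and the Einstein condition\<close>

context foliated_domain begin

text \<open>
  The Levi-Civita connection of the local quotient, applied to constant fields and lifted
  horizontally.
\<close>

definition base_cov :: "'v \<times> 'h \<Rightarrow> 'v \<times> 'h \<Rightarrow> 'v \<times> 'h \<Rightarrow> 'v \<times> 'h"
  where "base_cov u w y = hproj G y (cov y (hlift u y) (hlift w))"

lemma smooth_base_cov [smooth_intros]: "smooth_on S (base_cov u w)"
  unfolding base_cov_def[abs_def] by (intro smooth_intros)

lemma transversal_connection_hlift:
  assumes "y \<in> S" shows "transversal_connection G (\<lambda>_. u) (hlift w) y = base_cov u w y"
proof -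
  have "snd (lie_bracket (vpart G (\<lambda>_. u)) (hlift w) y) = 0"
    unfolding vpart_def
    by (rule snd_lie_bracket[where k = 0 and l = "snd w", OF assms smooth_on_vproj[OF smooth_const] smooth_hlift])
      (simp_all add: snd_vproj)
  then have "hproj G y (lie_bracket (vpart G (\<lambda>_. u)) (hlift w) y) = 0"
    by (rule hproj_eq_0[OF assms])
  then show ?thesis
    by (simp add: transversal_connection_def levi_civita_cov base_cov_def hpart_def hlift_def)
qed

text \<open>
  The vertical part of the constant field \<open>u\<close> vanishes at \<open>x\<close>, so at this point the bracket term of
  the outer transversal derivative is vertical and drops out.
\<close>

lemma transversal_riem_base_cov:
  assumes x: "x \<in> S" and u: "u \<in> horizontal_space G x" and v: "v \<in> horizontal_space G x"
    and z: "z \<in> horizontal_space G x"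
  shows "transversal_riem G x u v w z = G x (cov x v (base_cov u w)) z - G x (cov x u (base_cov v w)) z"
proof -
  have outer: "transversal_connection G (\<lambda>_. u) (transversal_connection G (\<lambda>_. v) (hlift w)) x =
      hproj G x (cov x u (base_cov v w))" if u: "u \<in> horizontal_space G x" for u v
  proof -
    let ?Y = "transversal_connection G (\<lambda>_. v) (hlift w)"
    let ?E = "vpart G (\<lambda>_. u)"
    have E0: "?E x = 0" using hproj_id[OF x u] by (simp add: vpart_def vproj_eq)
    have Y: "frechet_derivative ?Y (at x) = frechet_derivative (base_cov v w) (at x)"
      by (rule frechet_derivative_cong_open[OF open_S x transversal_connection_hlift])
    have "frechet_derivative ?Y (at x) 0 = 0"
      unfolding Y by (rule linear_0[OF has_derivative_linear[OF
            smooth_on_has_derivative[OF smooth_base_cov x]]])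
    moreover have "snd (frechet_derivative ?E (at x) k) = 0" for k
      unfolding vpart_def by (rule snd_frechet_derivative[OF x smooth_on_vproj[OF smooth_const] snd_vproj])
    ultimately have "snd (lie_bracket ?E ?Y x) = 0"
      by (simp add: lie_bracket_def E0)
    then have "hproj G x (lie_bracket ?E ?Y x) = 0" by (rule hproj_eq_0[OF x])
    moreover have "cov x (hpart G (\<lambda>_. u) x) ?Y = cov x u (base_cov v w)"
      using cov_cong[OF x transversal_connection_hlift] hproj_id[OF x u] by (simp add: hpart_def)
    ultimately show ?thesis by (simp add: transversal_connection_def levi_civita_cov)
  qed
  have zero: "lie_bracket (\<lambda>_. u) (\<lambda>_. v) = (\<lambda>_. 0)"
    by (simp add: lie_bracket_def fun_eq_iff)
  have v0: "vproj G y 0 = 0" if "y \<in> S" for y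
    using vproj_scaleR[OF that, of 0 0] by simp
  have last: "transversal_connection G (lie_bracket (\<lambda>_. u) (\<lambda>_. v)) (hlift w) x = 0"
    unfolding zero transversal_connection_hlift[OF x] base_cov_def
    using linear_0[OF cov_linear[OF x smooth_hlift, of w]] v0[OF x]
    by (simp add: hlift_def hproj_def)
  have lift: "hpart G (\<lambda>_. w) = hlift w" by (simp add: hpart_def hlift_def fun_eq_iff)
  show ?thesis
    unfolding transversal_riem_def curvature_def lift last outer[OF u] outer[OF v]
    using x by (simp add: G_hproj[OF x z])
qed

end

context umbilic_foliation_domain begin

text \<open>
  O'Neill's horizontal equation.  One of the three copies of $|A_u b|^2$ comes from the vertical part
  of the inner derivative, two from the bracket of the lifts, which equals $2 A_u b$.
\<close>

lemma transversal_riem_eq: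
  assumes x: "x \<in> S" and u: "u \<in> horizontal_space G x" and b: "b \<in> horizontal_space G x"
  defines "A \<equiv> vproj G x (cov x u (hlift b))"
  shows "transversal_riem G x u b u b = c * (G x u u * G x b b - (G x u b)\<^sup>2) + 3 * G x A A"
proof -
  let ?X = "hlift u" and ?Y = "hlift b"
  have Xx: "?X x = u" and Yx: "?Y x = b" using hlift_id[OF x] u b by blast+
  have A0: "snd A = 0" using snd_vproj[OF x] by (simp add: A_def)
  have A': "vproj G x (cov x b ?X) = - A"
    using vproj_cov_skew[OF x, of b u] by (simp add: A_def Xx Yx)
  (* The vertical part of the inner derivative, the part which base_cov lacks. *)
  define W where "W y = vproj G y (cov y (?Y y) ?X)" for y
  have W: "smooth_on S W" unfolding W_def by (intro smooth_intros)
  have t1: "G x (cov x u (\<lambda>y. cov y (?Y y) ?X)) b = G x (cov x u (base_cov b u)) b + G x A A"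
  proof -
    have "cov x u (\<lambda>y. cov y (?Y y) ?X) = cov x u (\<lambda>y. base_cov b u y + W y)"
      by (simp add: W_def base_cov_def hproj_def)
    also have "\<dots> = cov x u (base_cov b u) + cov x u W"
      by (rule cov_add[OF x smooth_base_cov W])
    moreover have "frechet_derivative (\<lambda>y. G y (W y) (?Y y)) (at x) u = frechet_derivative (\<lambda>y. 0) (at x) u"
      by (rule fun_cong, rule frechet_derivative_cong_open[OF open_S x])
        (simp add: W_def snd_vproj hlift_orth G_commute[of _ "vproj G _ _"])
    then have "G x (cov x u W) b = G x A (cov x u ?Y)"
      using metricity[OF x W smooth_hlift, of b u] x by (simp add: Yx W_def A')
    moreover have "G x A (cov x u ?Y) = G x A A"
      using G_vproj(2)[OF x A0] by (simp add: A_def)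
    ultimately show ?thesis using x by simp
  qed
  have t2: "cov x b (\<lambda>y. cov y (?X y) ?X) = cov x b (base_cov u u)"
    by (rule cov_cong[OF x]) (simp add: base_cov_def hproj_id[OF _ cov_hlift_self_horizontal])
  let ?L = "lie_bracket ?X ?Y x"
  have L: "?L = 2 *\<^sub>R A"
  proof -
    have 1: "?L = cov x u ?Y - cov x b ?X" using torsion_free[OF x, of ?X ?Y] by (simp add: Xx Yx)
    have "snd ?L = 0"
      by (rule snd_lie_bracket[where k = "snd u" and l = "snd b", OF x smooth_hlift smooth_hlift]) simp_all
    then have 2: "?L = vproj G x ?L" by (simp add: vproj_eq hproj_eq_0[OF x])
    have "vproj G x ?L = vproj G x (cov x u ?Y) - vproj G x (cov x b ?X)"
      unfolding 1 by (simp add: vproj_eq hproj_diff[OF x])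
    also have "\<dots> = 2 *\<^sub>R A" unfolding A' by (simp add: A_def scaleR_2)
    finally show ?thesis using 2 by (rule trans[rotated])
  qed
  have t3: "G x (cov x ?L ?X) b = - 2 * G x A A"
  proof -
    have "G x (cov x A ?X) b = G x (hproj G x (cov x A ?X)) b" by (simp add: G_hproj[OF x b])
    also have "hproj G x (cov x A ?X) = hproj G x (christoffel G x u A)"
      using hproj_cong_vertical[OF x snd_cov_vertical_commute[OF x A0]] Xx by metis
    also have "G x \<dots> b = G x b (christoffel G x u A)" using G_hproj[OF x b] G_commute[OF x] by metis
    also have "\<dots> = - G x (cov x u ?Y) A" using cov_hlift_vertical[OF x A0, of u b] Yx by simp
    also have "G x (cov x u ?Y) A = G x A A" using G_vproj(1)[OF x A0] by (simp add: A_def)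
    finally show ?thesis
      using linear_cmul[OF cov_linear[OF x smooth_hlift], of 2 A u] x by (simp add: L)
  qed
  have sym: "G x b u = G x u b" by (rule G_commute[OF x])
  have "(G x (cov x u (base_cov b u)) b + G x A A) - G x (cov x b (base_cov u u)) b - (- 2 * G x A A) =
      c * (G x u b * G x u b - G x u u * G x b b)"
    using curvature_fields_constant[OF x smooth_hlift smooth_hlift smooth_hlift, of u b u b]
    unfolding Xx Yx t1 t2 t3 sym .
  then show ?thesis
    unfolding transversal_riem_base_cov[OF x u b b] power2_eq_square right_diff_distrib by linarith
qed

text \<open>
  Tracing over an orthonormal basis of the horizontal space, the Einstein condition makes
  $\sum_b |A_u b|^2$ proportional to $|u|^2$.  By skewness this sum equals $\sum_e |A_u e|^2$ over a
  vertical orthonormal basis, and all terms of the latter are equal by the mixed equation.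
\<close>

lemma tensA_conformal:
  assumes x: "x \<in> S"
    and einstein: "\<And>u. u \<in> horizontal_space G x \<Longrightarrow> transversal_ric G x u = l * G x u u"
  shows "\<exists>m. \<forall>u\<in>horizontal_space G x. \<forall>v. snd v = 0 \<longrightarrow>
    G x (tensA x u v) (tensA x u v) = m * G x u u * G x v v"
proof -
  define B where "B = (SOME B. orthonormal_basis (G x) (horizontal_space G x) B)"
  have B: "orthonormal_basis (G x) (horizontal_space G x) B"
    unfolding B_def
    by (rule someI_ex[OF orthonormal_basis_exists[OF x subspace_horizontal[OF x]]])
  have finB: "finite B" and B_H: "\<And>b. b \<in> B \<Longrightarrow> b \<in> horizontal_space G x"
    and B1: "\<And>b. b \<in> B \<Longrightarrow> G x b b = 1"
    using B by (auto simp: orthonormal_basis_def)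
  obtain C where C: "orthonormal_basis (G x) vertical_space C"
    using orthonormal_basis_exists[OF x subspace_vertical] by blast
  have finC: "finite C" and C_V: "\<And>e. e \<in> C \<Longrightarrow> snd e = 0"
    and C1: "\<And>e. e \<in> C \<Longrightarrow> G x e e = 1" and spanC: "span C = vertical_space"
    using C by (auto simp: orthonormal_basis_def subset_iff vertical_iff)
  have "C \<noteq> {}"
  proof
    assume "C = {}"
    then have "vertical_space = {0::'v \<times> 'h}" using spanC by simp
    then show False using vertical_nonzero_exists by (auto simp: vertical_iff[symmetric])
  qed
  then have cardC: "card C > 0" using finC by (simp add: card_gt_0_iff)
  let ?A = "\<lambda>u b. vproj G x (cov x u (hlift b))"
  have "G x (tensA x u v) (tensA x u v) = ((l - c * (real (card B) - 1)) / (3 * real (card C))) * G x u u * G x v v"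
    if u: "u \<in> horizontal_space G x" and v: "snd v = 0" for u v
  proof -
    obtain \<phi> where \<phi>: "\<And>v. snd v = 0 \<Longrightarrow> G x (tensA x u v) (tensA x u v) = \<phi> * G x v v"
      using tensA_conformal_vertical[OF x u] by blast
    have Ab: "G x (?A u b) (?A u b) = (\<Sum>e\<in>C. (G x (tensA x u e) b)\<^sup>2)" if b: "b \<in> B" for b
    proof -
      have "?A u b \<in> vertical_space" by (simp add: vertical_iff snd_vproj[OF x])
      then have "G x (?A u b) (?A u b) = (\<Sum>e\<in>C. (G x (?A u b) e)\<^sup>2)"
        by (rule orthonormal_basis_norm[OF x C])
      also have "\<dots> = (\<Sum>e\<in>C. (G x (tensA x u e) b)\<^sup>2)"
      proof (rule sum.cong[OF refl])
        fix e assume "e \<in> C"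
        then have "G x (?A u b) e = - G x b (christoffel G x u e)"
          using cov_hlift_vertical[OF x C_V, of e u b] C_V
          by (simp add: G_vproj[OF x] hlift_id[OF x B_H[OF b]])
        also have "\<dots> = - G x (tensA x u e) b"
          unfolding tensA_def using G_hproj[OF x B_H[OF b]] G_commute[OF x] by metis
        finally show "(G x (?A u b) e)\<^sup>2 = (G x (tensA x u e) b)\<^sup>2" by simp
      qed
      finally show ?thesis .
    qed
    have "(\<Sum>b\<in>B. G x (?A u b) (?A u b)) = (\<Sum>b\<in>B. \<Sum>e\<in>C. (G x (tensA x u e) b)\<^sup>2)"
      by (rule sum.cong[OF refl Ab])
    also have "\<dots> = (\<Sum>e\<in>C. \<Sum>b\<in>B. (G x (tensA x u e) b)\<^sup>2)"
      by (rule sum.swap)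
    also have "\<dots> = (\<Sum>e\<in>C. G x (tensA x u e) (tensA x u e))"
    proof (rule sum.cong[OF refl])
      fix e
      have "tensA x u e \<in> horizontal_space G x" by (simp add: tensA_def hproj_horizontal[OF x])
      then show "(\<Sum>b\<in>B. (G x (tensA x u e) b)\<^sup>2) = G x (tensA x u e) (tensA x u e)"
        by (rule orthonormal_basis_norm[OF x B, symmetric])
    qed
    also have "\<dots> = real (card C) * \<phi>" using \<phi> C_V C1 by simp
    finally have sumA: "(\<Sum>b\<in>B. G x (?A u b) (?A u b)) = real (card C) * \<phi>" .
    have sumB: "(\<Sum>b\<in>B. (G x u b)\<^sup>2) = G x u u"
      by (rule orthonormal_basis_norm[OF x B u, symmetric])
    have "l * G x u u = (\<Sum>b\<in>B. c * (G x u u * G x b b - (G x u b)\<^sup>2) + 3 * G x (?A u b) (?A u b))"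
      unfolding einstein[OF u, symmetric] transversal_ric_def B_def[symmetric]
      by (rule sum.cong[OF refl]) (rule transversal_riem_eq[OF x u B_H])
    also have "\<dots> = c * (\<Sum>b\<in>B. G x u u - (G x u b)\<^sup>2) + 3 * (\<Sum>b\<in>B. G x (?A u b) (?A u b))"
      using B1 by (simp add: sum.distrib sum_distrib_left)
    also have "\<dots> = c * (real (card B) * G x u u - G x u u) + 3 * (real (card C) * \<phi>)"
      by (simp add: sum_subtractf sumA sumB)
    finally have "\<phi> = ((l - c * (real (card B) - 1)) / (3 * real (card C))) * G x u u"
      using cardC by (simp add: field_simps)
    then show ?thesis using \<phi>[OF v] by simp
  qed
  then show ?thesis by blast
qed

end


section \<open>Derivatives of the integrability tensor and the conclusion\<close>

context umbilic_foliation_domain begin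

text \<open>
  The vanishing of the component $R(u_1,u_2,u_3,v)$; the last term comes from the bracket
  $[X_1,X_2] = 2 A_{X_1} X_2$ and umbilicity.
\<close>

lemma codazzi_horizontal:
  assumes x: "x \<in> S" and v: "snd v = 0"
    and u: "u1 \<in> horizontal_space G x" "u2 \<in> horizontal_space G x" "u3 \<in> horizontal_space G x"
  shows "frechet_derivative (\<lambda>y. G y (cov y (hlift u2 y) (hlift u3)) v) (at x) u1
      - frechet_derivative (\<lambda>y. G y (cov y (hlift u1 y) (hlift u3)) v) (at x) u2
    = G x (cov x u2 (hlift u3)) (christoffel G x u1 v) - G x (cov x u1 (hlift u3)) (christoffel G x u2 v)
      - 2 * G x (N x) u3 * G x (cov x u1 (hlift u2)) v"
proof -
  note lift = hlift_id[OF x u(1)] hlift_id[OF x u(2)] hlift_id[OF x u(3)]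
  let ?L = "lie_bracket (hlift u1) (hlift u2) x"
  have "smooth_on S (\<lambda>y. cov y (hlift a y) (hlift b))" for a b by (intro smooth_intros)
  from metricity[OF x this smooth_const]
  have d: "frechet_derivative (\<lambda>y. G y (cov y (hlift a y) (hlift b)) v) (at x) w =
      G x (cov x w (\<lambda>y. cov y (hlift a y) (hlift b))) v
      + G x (cov x (hlift a x) (hlift b)) (christoffel G x w v)" for a b w
    by (simp add: cov_const)
  have L: "snd ?L = 0"
    by (rule snd_lie_bracket[where k = "snd u1" and l = "snd u2", OF x smooth_hlift smooth_hlift]) simp_all
  have "G x (cov x u2 (hlift u1)) v = - G x (cov x u1 (hlift u2)) v"
    using cov_hlift_skew[OF x v, of u2 u1] by (simp add: lift)
  then have Lv: "G x ?L v = 2 * G x (cov x u1 (hlift u2)) v"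
    using torsion_free[OF x, of "hlift u1" "hlift u2"] x by (simp add: lift)
  have "G x (cov x ?L (hlift u3)) v = - (G x (N x) u3 * G x ?L v)"
    using cov_hlift_vertical[OF x v, of ?L u3] G_christoffel_vertical[OF x L v u(3)]
      G_commute[OF x, of u3] by (simp add: lift)
  moreover have "G x u1 v = 0" "G x u2 v = 0"
    using u v unfolding horizontal_iff by blast+
  ultimately show ?thesis
    using curvature_fields_constant[OF x smooth_hlift smooth_hlift smooth_hlift, of u1 u2 u3 v]
    unfolding d lift Lv by simp
qed

text \<open>
  The preceding identity and its two cyclic permutations form a linear system for the three
  derivatives involved, which is solved for one of them.  The first three terms on the right only
  account for the connection, the last three are the covariant derivative of \<open>A\<close>.
\<close>

lemma tensA_derivative:
  assumes x: "x \<in> S" and v: "snd v = 0"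
    and u: "u1 \<in> horizontal_space G x" "u2 \<in> horizontal_space G x" "u3 \<in> horizontal_space G x"
  shows "frechet_derivative (\<lambda>y. G y (cov y (hlift u1 y) (hlift u2)) v) (at x) u3 =
      G x (hproj G x (cov x u3 (hlift u1))) (christoffel G x u2 v)
      - G x (hproj G x (cov x u3 (hlift u2))) (christoffel G x u1 v)
      + G x (vproj G x (cov x u1 (hlift u2))) (christoffel G x u3 v)
      - G x (N x) u1 * G x (cov x u2 (hlift u3)) v - G x (N x) u2 * G x (cov x u3 (hlift u1)) v
      + G x (N x) u3 * G x (cov x u1 (hlift u2)) v"
proof -
  note lift = hlift_id[OF x u(1)] hlift_id[OF x u(2)] hlift_id[OF x u(3)]
  let ?D = "\<lambda>a b w. frechet_derivative (\<lambda>y. G y (cov y (hlift a y) (hlift b)) v) (at x) w"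
  (* The horizontal part g is symmetric in its first two arguments, the vertical part t is skew. *)
  let ?g = "\<lambda>a b w. G x (hproj G x (cov x a (hlift b))) (christoffel G x w v)"
  let ?t = "\<lambda>a b w. G x (vproj G x (cov x a (hlift b))) (christoffel G x w v)"
  have skew: "?D a b w = - ?D b a w" for a b w
  proof -
    have "?D a b w = frechet_derivative (\<lambda>y. - G y (cov y (hlift b y) (hlift a)) v) (at x) w"
      by (rule fun_cong, rule frechet_derivative_cong_open[OF open_S x]) (rule cov_hlift_skew[OF _ v])
    also have "\<dots> = - ?D b a w"
    proof -
      have "smooth_on S (\<lambda>y. G y (cov y (hlift b y) (hlift a)) v)" by (intro smooth_intros)
      from smooth_on_has_derivative[OF this x] show ?thesis
        by (rule fun_cong[OF frechet_derivative_at[OF has_derivative_minus], symmetric])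
    qed
    finally show ?thesis .
  qed
  have g: "?g u2 u1 w = ?g u1 u2 w" "?g u3 u1 w = ?g u1 u3 w" "?g u3 u2 w = ?g u2 u3 w" for w
    using hproj_cov_sym[OF x, of u1 u2] hproj_cov_sym[OF x, of u1 u3] hproj_cov_sym[OF x, of u2 u3]
    by (simp_all add: lift)
  have t: "?t u2 u1 w = - ?t u1 u2 w" "?t u3 u1 w = - ?t u1 u3 w" "?t u3 u2 w = - ?t u2 u3 w" for w
    using vproj_cov_skew[OF x, of u2 u1] vproj_cov_skew[OF x, of u3 u1] vproj_cov_skew[OF x, of u3 u2] x
    by (simp_all add: lift)
  have split: "G x (cov x a (hlift b)) (christoffel G x w v) = ?g a b w + ?t a b w" for a b w
    by (rule G_split[OF x])
  have "?D u2 u3 u1 - ?D u1 u3 u2 = ?g u2 u3 u1 + ?t u2 u3 u1 - (?g u1 u3 u2 + ?t u1 u3 u2)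
      - 2 * (G x (N x) u3 * G x (cov x u1 (hlift u2)) v)"
    using codazzi_horizontal[OF x v u(1,2,3)] unfolding split by simp
  moreover have "?D u3 u1 u2 - ?D u2 u1 u3 = ?g u3 u1 u2 + ?t u3 u1 u2 - (?g u2 u1 u3 + ?t u2 u1 u3)
      - 2 * (G x (N x) u1 * G x (cov x u2 (hlift u3)) v)"
    using codazzi_horizontal[OF x v u(2,3,1)] unfolding split by simp
  moreover have "?D u1 u2 u3 - ?D u3 u2 u1 = ?g u1 u2 u3 + ?t u1 u2 u3 - (?g u3 u2 u1 + ?t u3 u2 u1)
      - 2 * (G x (N x) u2 * G x (cov x u3 (hlift u1)) v)"
    using codazzi_horizontal[OF x v u(3,1,2)] unfolding split by simp
  moreover have "?D u3 u1 u2 = - ?D u1 u3 u2" "?D u2 u1 u3 = - ?D u1 u2 u3" "?D u3 u2 u1 = - ?D u2 u3 u1"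
    by (rule skew)+
  ultimately show ?thesis
    using g[of u1] g[of u2] g[of u3] t[of u1] t[of u2] t[of u3] by linarith
qed

lemma tensA_horizontal: "x \<in> S \<Longrightarrow> tensA x u v \<in> horizontal_space G x"
  by (simp add: tensA_def hproj_horizontal)

lemma tensA_skew:
  assumes "x \<in> S" "snd v = 0" "u \<in> horizontal_space G x" "w \<in> horizontal_space G x"
  shows "G x (tensA x u v) w = - G x (tensA x w v) u"
  using christoffel_skew[OF assms] by (simp add: tensA_def G_hproj[OF assms(1,3)] G_hproj[OF assms(1,4)])

context
  fixes m :: "'v \<times> 'h \<Rightarrow> real"
  assumes conformal: "\<And>x u v. x \<in> S \<Longrightarrow> u \<in> horizontal_space G x \<Longrightarrow> snd v = 0 \<Longrightarrow>
    G x (tensA x u v) (tensA x u v) = m x * G x u u * G x v v"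
begin

lemma conformal_horizontal:
  assumes x: "x \<in> S" and v: "snd v = 0" and u: "u \<in> horizontal_space G x" "w \<in> horizontal_space G x"
  shows "G x (tensA x u v) (tensA x w v) = m x * G x u w * G x v v"
proof -
  have uw: "u + w \<in> horizontal_space G x" using subspace_add[OF subspace_horizontal[OF x]] u by blast
  have "tensA x (u + w) v = tensA x u v + tensA x w v" using x by (simp add: tensA_def hproj_add)
  then show ?thesis
    using conformal[OF x uw v] conformal[OF x u(1) v] conformal[OF x u(2) v] x
      G_commute[OF x, of w u] G_commute[OF x, of "tensA x w v" "tensA x u v"] by (simp add: algebra_simps)
qed

lemma conformal_vertical:
  assumes x: "x \<in> S" and v: "snd v = 0" "snd v' = 0" and u: "u \<in> horizontal_space G x"
  shows "G x (tensA x u v) (tensA x u v') = m x * G x u u * G x v v'"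
proof -
  have vv: "snd (v + v') = 0" using v by simp
  have "tensA x u (v + v') = tensA x u v + tensA x u v'" using x by (simp add: tensA_def hproj_add)
  then show ?thesis
    using conformal[OF x u vv] conformal[OF x u v(1)] conformal[OF x u v(2)] x
      G_commute[OF x, of v' v] G_commute[OF x, of "tensA x u v'" "tensA x u v"] by (simp add: algebra_simps)
qed

text \<open>
  The factor is the quotient of the two sides of the conformality relation for one fixed lift and one
  fixed vertical vector.
\<close>

lemma smooth_m: "smooth_on S m"
proof -
  obtain v :: "'v \<times> 'h" where v: "snd v = 0" "v \<noteq> 0" using vertical_nonzero_exists by blast
  obtain b :: 'h where b: "b \<noteq> 0" by (metis nonempty_Basis ex_in_conv nonzero_Basis)
  let ?X = "hlift (0, b)"
  have X: "?X x \<noteq> 0" if "x \<in> S" for x using snd_hlift[OF that, of "(0, b)"] b by auto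
  have pos: "G x (?X x) (?X x) * G x v v > 0" if "x \<in> S" for x
    using G_pos[OF that X[OF that]] G_pos[OF that v(2)] by simp
  show ?thesis
  proof (rule smooth_on_cong[OF open_S])
    show "smooth_on S (\<lambda>x. G x (tensA x (?X x) v) (tensA x (?X x) v) / (G x (?X x) (?X x) * G x v v))"
      unfolding tensA_def by (intro smooth_intros open_S pos)
    fix x assume x: "x \<in> S"
    show "G x (tensA x (?X x) v) (tensA x (?X x) v) / (G x (?X x) (?X x) * G x v v) = m x"
      using conformal[OF x hlift_horizontal[OF x] v(1), of "(0, b)"] pos[OF x]
      by (simp only: mult.assoc) (metis nonzero_mult_div_cancel_right less_irrefl)
  qed
qed

text \<open>
  The conformality relation for a lift of \<open>u\<close> and the constant field \<open>v\<close> is differentiated along \<open>w\<close>.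
  The connection terms of both sides agree, again by conformality, and leave the derivative of \<open>m\<close>
  against the covariant derivative of \<open>A\<close>.
\<close>

lemma conformal_derivative:
  assumes x: "x \<in> S" and v: "snd v = 0"
    and u: "u \<in> horizontal_space G x" and w: "w \<in> horizontal_space G x"
  shows "frechet_derivative m (at x) w / 2 * G x u u * G x v v =
    m x * G x (N x) u * G x w u * G x v v + G x (N x) (tensA x u v) * G x w (tensA x u v)
    + m x * G x (N x) w * G x u u * G x v v"
proof -
  let ?X = "hlift u" and ?Z = "hlift w"
  (* P is the field A_X V; Y is the basic field that agrees with it at x. *)
  define P where "P y = tensA y (?X y) v" for y
  define q where "q = P x"
  let ?Y = "hlift q"
  have Xx: "?X x = u" and Zx: "?Z x = w" using hlift_id[OF x] u w by blast+
  have qA: "q = tensA x u v" by (simp add: q_def P_def Xx)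
  have q: "q \<in> horizontal_space G x" unfolding qA by (rule tensA_horizontal[OF x])
  have Yx: "?Y x = q" by (rule hlift_id[OF x q])
  have P_smooth: "smooth_on S P" unfolding P_def tensA_def by (intro smooth_intros)
  have Gq: "G x q z = G x (christoffel G x u v) z" if "z \<in> horizontal_space G x" for z
    unfolding qA tensA_def by (rule G_hproj(1)[OF x that])
  note dX = metricity[OF x smooth_hlift smooth_hlift, of u u w]
  let ?dm = "frechet_derivative m (at x) w"
  (* The derivative of |P|^2 along w, computed from its value. *)
  have "2 * G x (cov x w P) q = frechet_derivative (\<lambda>y. G y (P y) (P y)) (at x) w"
    using metricity[OF x P_smooth P_smooth, of w] G_commute[OF x, of q "cov x w P"] by (simp add: q_def)
  also have "\<dots> = frechet_derivative (\<lambda>y. m y * (G y (?X y) (?X y) * G y v v)) (at x) w"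
    by (rule fun_cong, rule frechet_derivative_cong_open[OF open_S x])
      (simp add: P_def conformal[OF _ hlift_horizontal v])
  also have "\<dots> = m x * (G x u u * (2 * G x (christoffel G x w v) v) + (2 * G x (cov x w ?X) u) * G x v v)
      + ?dm * (G x u u * G x v v)"
  proof -
    have X2: "smooth_on S (\<lambda>y. G y (?X y) (?X y))" by (intro smooth_intros)
    from has_derivative_mult[OF smooth_on_has_derivative[OF smooth_m x] has_derivative_mult[OF
        smooth_on_has_derivative[OF X2 x] smooth_on_has_derivative[OF smooth_G_const x, of v v]]]
    have 1: "frechet_derivative (\<lambda>y. m y * (G y (?X y) (?X y) * G y v v)) (at x) w =
       m x * (G x (?X x) (?X x) * frechet_derivative (\<lambda>y. G y v v) (at x) w
         + frechet_derivative (\<lambda>y. G y (?X y) (?X y)) (at x) w * G x v v)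
       + ?dm * (G x (?X x) (?X x) * G x v v)"
      by (rule fun_cong[OF frechet_derivative_at, symmetric])
    have 2: "frechet_derivative (\<lambda>y. G y v v) (at x) w = 2 * G x (christoffel G x w v) v"
      using metricity[OF x smooth_const smooth_const, of v v w]
        G_commute[OF x, of v "christoffel G x w v"] by (simp add: cov_const)
    have 3: "frechet_derivative (\<lambda>y. G y (?X y) (?X y)) (at x) w = 2 * G x (cov x w ?X) u"
      using dX G_commute[OF x, of u "cov x w ?X"] by (simp add: Xx)
    show ?thesis unfolding 1 2 3 Xx ..
  qed
  finally have dP_value: "G x (cov x w P) q = m x * G x u u * G x (christoffel G x w v) v
      + m x * G x (cov x w ?X) u * G x v v + ?dm / 2 * G x u u * G x v v"
    by (simp add: algebra_simps)
  (* The same derivative, computed from the derivative of A. *)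
  let ?D = "frechet_derivative (\<lambda>y. G y (cov y (?X y) ?Y) v) (at x) w"
  have "frechet_derivative (\<lambda>y. G y (P y) (?Y y)) (at x) w = - ?D"
  proof -
    have eq: "G y (P y) (?Y y) = - G y (cov y (?X y) ?Y) v" if y: "y \<in> S" for y
      using cov_hlift_vertical[OF y v, of "?X y" q] G_hproj(1)[OF y hlift_horizontal[OF y]]
        G_commute[OF y, of "?Y y" "christoffel G y (?X y) v"] by (simp add: P_def tensA_def)
    have sm: "smooth_on S (\<lambda>y. G y (cov y (?X y) ?Y) v)" by (intro smooth_intros)
    have "frechet_derivative (\<lambda>y. G y (P y) (?Y y)) (at x) w =
        frechet_derivative (\<lambda>y. - G y (cov y (?X y) ?Y) v) (at x) w"
      by (rule fun_cong, rule frechet_derivative_cong_open[OF open_S x eq])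
    also have "\<dots> = - ?D"
      by (rule fun_cong[OF frechet_derivative_at[OF has_derivative_minus[OF
              smooth_on_has_derivative[OF sm x]]], symmetric])
    finally show ?thesis .
  qed
  then have dP: "G x (cov x w P) q = - ?D - G x q (cov x w ?Y)"
    using metricity[OF x P_smooth smooth_hlift, of q w] by (simp add: q_def[symmetric] Yx)
  have "G x q (cov x w ?Y) = G x (christoffel G x u v) (hproj G x (cov x w ?Y))"
    using G_hproj(2)[OF x q] Gq[OF hproj_horizontal[OF x]] by metis
  then have c1: "G x q (cov x w ?Y) = G x (hproj G x (cov x w ?Y)) (christoffel G x u v)"
    using G_commute[OF x] by metis
  have c2: "G x (hproj G x (cov x w ?X)) (christoffel G x q v) = - m x * G x (cov x w ?X) u * G x v v"
  proof -
    let ?h = "hproj G x (cov x w ?X)"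
    have h: "?h \<in> horizontal_space G x" by (rule hproj_horizontal[OF x])
    have "G x ?h (christoffel G x q v) = G x (tensA x q v) ?h"
      unfolding tensA_def G_hproj(1)[OF x h] by (rule G_commute[OF x])
    also have "\<dots> = - G x (tensA x ?h v) q" by (rule tensA_skew[OF x v q h])
    also have "\<dots> = - (m x * G x ?h u * G x v v)" unfolding qA by (simp add: conformal_horizontal[OF x v h u])
    also have "G x ?h u = G x (cov x w ?X) u" by (rule G_hproj(1)[OF x u])
    finally show ?thesis by simp
  qed
  have c3: "G x (vproj G x (cov x u ?Y)) (christoffel G x w v) = - m x * G x u u * G x (christoffel G x w v) v"
  proof -
    let ?W = "vproj G x (christoffel G x w v)"
    have W: "snd ?W = 0" by (rule snd_vproj[OF x])
    have "G x (vproj G x (cov x u ?Y)) (christoffel G x w v) = G x (cov x u ?Y) ?W"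
      using G_vproj[OF x] snd_vproj[OF x] by metis
    also have "\<dots> = - G x q (christoffel G x u ?W)" using cov_hlift_vertical[OF x W, of u q] by (simp add: Yx)
    also have "G x q (christoffel G x u ?W) = G x (tensA x u v) (tensA x u ?W)"
      unfolding tensA_def[of x u ?W] qA[symmetric] by (rule G_hproj(2)[OF x q, symmetric])
    also have "\<dots> = m x * G x u u * G x v ?W" by (rule conformal_vertical[OF x v W u])
    also have "G x v ?W = G x (christoffel G x w v) v" using G_vproj(2)[OF x v] G_commute[OF x] by metis
    finally show ?thesis by simp
  qed
  have c4: "G x (cov x q ?Z) v = m x * G x w u * G x v v"
  proof -
    have "G x (cov x q ?Z) v = - G x (tensA x q v) w"
      using cov_hlift_vertical[OF x v, of q w] G_hproj(1)[OF x w]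
        G_commute[OF x, of w "christoffel G x q v"] by (simp add: Zx tensA_def)
    also have "\<dots> = G x (tensA x w v) q" using tensA_skew[OF x v q w] by simp
    finally show ?thesis unfolding qA by (simp add: conformal_horizontal[OF x v w u])
  qed
  have c5: "G x (cov x w ?X) v = G x w q"
  proof -
    have "G x (cov x w ?X) v = - G x (tensA x w v) u"
      using cov_hlift_vertical[OF x v, of w u] G_hproj(1)[OF x u]
        G_commute[OF x, of u "christoffel G x w v"] by (simp add: Xx tensA_def)
    also have "\<dots> = G x (tensA x u v) w" using tensA_skew[OF x v w u] by simp
    finally show ?thesis unfolding qA by (simp only: G_commute[OF x, of w])
  qed
  have c6: "G x (cov x u ?Y) v = - m x * G x u u * G x v v"
    using cov_hlift_vertical[OF x v, of u q] Gq[OF q] G_commute[OF x, of q "christoffel G x u v"]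
      conformal[OF x u v] by (simp add: Yx qA[symmetric])
  have "G x (cov x w P) q = m x * G x (cov x w ?X) u * G x v v + m x * G x u u * G x (christoffel G x w v) v
      + m x * G x (N x) u * G x w u * G x v v + G x (N x) q * G x w q + m x * G x (N x) w * G x u u * G x v v"
    using dP c1 tensA_derivative[OF x v u q w] unfolding c2 c3 c4 c5 c6 by (simp add: algebra_simps)
  then show ?thesis using dP_value unfolding qA by linarith
qed

text \<open>
  The derivative of \<open>m\<close> along \<open>N\<close> is computed twice with the preceding lemma, for $u = N$ and for
  $u = A_N e$ with \<open>e\<close> orthogonal to \<open>v\<close>; the results differ by a factor of two.
\<close>

lemma N_eq_0:
  assumes x: "x \<in> S" and m: "m x \<noteq> 0" and dim: "DIM('v) \<ge> 2"
  shows "N x = 0"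
proof (rule ccontr)
  assume N0: "N x \<noteq> 0"
  let ?n = "N x" and ?f = "G x (N x) (N x)" and ?k = "frechet_derivative m (at x) (N x) / 2"
  have n: "?n \<in> horizontal_space G x" by (rule N_horizontal[OF x])
  have f: "?f > 0" by (rule G_pos[OF x N0])
  (* v and e are orthogonal vertical vectors. *)
  obtain b b' :: 'v where b: "b \<in> Basis" "b' \<in> Basis" "b \<noteq> b'"
  proof -
    have "\<not> card (Basis :: 'v set) \<le> Suc 0" using dim by simp
    then show ?thesis using that card_le_Suc0_iff_eq[OF finite_Basis] by blast
  qed
  define v where "v = (b, 0::'h)"
  define e where "e = (b', 0::'h) - (G x (b', 0) v / G x v v) *\<^sub>R v"
  have v: "snd v = 0" "v \<noteq> 0" using b by (auto simp: v_def zero_prod_def)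
  have e: "snd e = 0" using v by (simp add: e_def)
  have "fst e \<bullet> b' = 1" using b inner_Basis[of b' b'] inner_Basis[of b b'] by (simp add: e_def v_def inner_diff_left)
  then have e0: "e \<noteq> 0" by auto
  have gv: "G x v v > 0" and ge: "G x e e > 0" using G_pos[OF x] v(2) e0 by blast+
  have "G x e v = 0" using gv x by (simp add: e_def)
  then have ve: "G x v e = 0" using G_commute[OF x] by simp
  have self: "G x ?n (tensA x ?n z) = 0" if "snd z = 0" for z
    using tensA_skew[OF x that n n] G_commute[OF x] by simp
  have "?k * ?f * G x v v = 2 * (m x * ?f) * ?f * G x v v"
    using conformal_derivative[OF x v(1) n n] self[OF v(1)] by (simp add: algebra_simps)
  then have k1: "?k = 2 * (m x * ?f)" using f gv by simp
  (* This u is orthogonal to N, and A_u v is as well, since v and e are orthogonal. *)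
  define u where "u = tensA x ?n e"
  have u: "u \<in> horizontal_space G x" unfolding u_def by (rule tensA_horizontal[OF x])
  have uu: "G x u u = m x * ?f * G x e e" unfolding u_def by (rule conformal[OF x n e])
  then have uu0: "G x u u \<noteq> 0" using m f ge by simp
  have nu: "G x ?n u = 0" unfolding u_def by (rule self[OF e])
  have "G x (tensA x u v) ?n = - G x (tensA x ?n v) u" by (rule tensA_skew[OF x v(1) u n])
  also have "\<dots> = 0" unfolding u_def conformal_vertical[OF x v(1) e n] by (simp add: ve)
  finally have "G x ?n (tensA x u v) = 0" using G_commute[OF x] by simp
  then have "?k * G x u u * G x v v = (m x * ?f) * G x u u * G x v v"
    using conformal_derivative[OF x v(1) u n] nu by simp
  then have "?k = m x * ?f" using uu0 gv by simp
  then show False using k1 m f by simp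
qed

end

text \<open>
  On pairs of horizontal vectors \<open>A\<close> is minus the adjoint of its action on vertical ones.
\<close>

lemma oneill_A_eq_0:
  assumes x: "x \<in> S"
    and A: "\<And>u v. u \<in> horizontal_space G x \<Longrightarrow> snd v = 0 \<Longrightarrow> tensA x u v = 0"
  shows "A_at G x u v = 0"
proof -
  let ?u = "hproj G x u"
  have h: "?u \<in> horizontal_space G x" by (rule hproj_horizontal[OF x])
  let ?W = "vpart G (\<lambda>_. v)"
  have W: "smooth_on S ?W" "snd (?W x) = 0"
    unfolding vpart_def by (intro smooth_intros) (simp add: snd_vproj[OF x])
  have "snd (frechet_derivative ?W (at x) ?u) = 0"
    by (rule snd_frechet_derivative[OF x W(1)]) (simp add: vpart_def snd_vproj)
  then have "hproj G x (cov x ?u ?W) = tensA x ?u (?W x)"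
    unfolding cov_def tensA_def using x by (simp add: hproj_add hproj_eq_0)
  then have 1: "hproj G x (cov x ?u ?W) = 0" using A[OF h W(2)] by simp
  have "vproj G x (cov x ?u (hlift v)) = 0"
  proof (rule vertical_eqI[OF x])
    fix w :: "'v \<times> 'h" assume w: "snd w = 0"
    have "G x (hlift v x) (christoffel G x ?u w) = G x (hlift v x) (tensA x ?u w)"
      unfolding tensA_def by (rule G_hproj(2)[OF x hlift_horizontal[OF x], symmetric])
    then show "G x (vproj G x (cov x ?u (hlift v))) w = G x 0 w"
      using cov_hlift_vertical[OF x w, of ?u v] A[OF h w] x w by (simp add: G_vproj)
  qed (simp_all add: snd_vproj[OF x])
  moreover have "hpart G (\<lambda>_. v) = hlift v" by (simp add: hpart_def hlift_def fun_eq_iff)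
  ultimately show ?thesis
    using 1 by (simp add: A_at_def oneill_A_def levi_civita_cov hpart_def[of G "\<lambda>_. u"])
qed

end

lemma T_at_vertical:
  assumes "foliated_domain S G" "x \<in> S" "snd u = 0" "snd v = 0"
  shows "T_at G x u v = hproj G x (christoffel G x u v)"
proof -
  interpret foliated_domain S G by fact
  have h0: "hpart G (\<lambda>_. v) = (\<lambda>y. hproj G y v)" by (simp add: hpart_def)
  have v: "vproj G y w = w" if "y \<in> S" "snd w = 0" for y w
    using hproj_eq_0[OF that] by (simp add: vproj_eq)
  have 1: "cov x u (vpart G (\<lambda>_. v)) = cov x u (\<lambda>_. v)"
    by (rule cov_cong[OF assms(2)]) (simp add: vpart_def v assms(4))
  have 2: "cov x u (hpart G (\<lambda>_. v)) = cov x u (\<lambda>_. 0)"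
    by (rule cov_cong[OF assms(2)]) (simp add: hpart_def hproj_eq_0 assms(4))
  have "vproj G x 0 = 0" using v[OF assms(2), of 0] by simp
  then show ?thesis
    using 1 2 v[OF assms(2,3)] assms(2)
    by (simp add: T_at_def oneill_T_def levi_civita_cov vpart_def[of G "\<lambda>_. u"] cov_const)
qed

theorem theorem2p8:
  fixes \<A> \<F> :: "('m::{t2_space,second_countable_topology},
      'v::euclidean_space \<times> 'h::euclidean_space) chart set"
    and g :: "('m, 'v \<times> 'h) chart \<Rightarrow> ('v \<times> 'h) coord_metric"
    and c :: real
  assumes "smooth_manifold \<A>"
    and "riemannian_metric \<A> g"
    and "constant_curvature \<A> g c"
    and "foliation \<A> \<F>"
    and "bundle_like \<F> g"
    and "totally_umbilical \<F> g"
    and "DIM('v) \<ge> 2"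
    and "horizontally_nonintegrable \<F> g"
    and "transversally_einstein_like \<A> \<F> g"
  shows "totally_geodesic \<F> g"
  unfolding totally_geodesic_def
proof (intro ballI)
  fix \<kappa> x and u v :: "'v \<times> 'h"
  assume \<kappa>: "\<kappa> \<in> \<F>" and x: "x \<in> chart_image \<kappa>" and u: "u \<in> vertical_space" and v: "v \<in> vertical_space"
  define S where "S = chart_image \<kappa>"
  define G where "G = g \<kappa>"
  define N where "N y = (1 / real DIM('v)) *\<^sub>R mean_curvature G y" for y
  have \<kappa>A: "\<kappa> \<in> \<A>" using assms(4) \<kappa> by (auto simp: foliation_def)
  have xS: "x \<in> S" using x by (simp add: S_def)
  have "foliated_domain S G"
  proof
    show "open S" using assms(1) \<kappa>A by (auto simp: smooth_manifold_def is_chart_def S_def)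
    show "coord_metric_on S G" using assms(2) \<kappa>A by (auto simp: riemannian_metric_def S_def G_def)
  qed
  then interpret foliated_domain S G .
  interpret umbilic_foliation_domain S G c N
  proof
    show "frechet_derivative (\<lambda>y. G y (hlift u y) (hlift u y)) (at y) w = 0"
      if "y \<in> S" "snd w = 0" for y u w
    proof -
      have "basic_field G S (hlift u)"
        unfolding basic_field_def
        by (intro conjI ballI exI[of _ "\<lambda>_. snd u"]) (simp_all add: smooth_hlift hlift_horizontal)
      then show ?thesis
        using assms(5) \<kappa> open_S that unfolding bundle_like_def S_def G_def vertical_iff[symmetric]
        by blast
    qed
    show "sectional_curvature G y u v = c" if "y \<in> S" "u \<noteq> v" "independent {u, v}" for y u v
      using assms(3) \<kappa>A that unfolding constant_curvature_def S_def G_def by blast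
    show "hproj G y (christoffel G y u v) = G y u v *\<^sub>R N y" if "y \<in> S" "snd u = 0" "snd v = 0" for y u v
    proof -
      have "T_at G y u v = (1 / real DIM('v) * G y u v) *\<^sub>R mean_curvature G y"
        using assms(6) \<kappa> that unfolding totally_umbilical_def S_def G_def vertical_iff[symmetric] by blast
      then show ?thesis
        using T_at_vertical[OF \<open>foliated_domain S G\<close> that] by (simp add: N_def mult.commute)
    qed
  qed
  obtain l where "\<And>y w. y \<in> S \<Longrightarrow> w \<in> horizontal_space G y \<Longrightarrow>
      transversal_ric G y w = l (chart_inv \<kappa> y) * G y w w"
    using assms(9) \<kappa> unfolding transversally_einstein_like_def S_def G_def by blast
  then have "\<forall>y. \<exists>m. y \<in> S \<longrightarrow> (\<forall>u\<in>horizontal_space G y. \<forall>v. snd v = 0 \<longrightarrow>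
      G y (tensA y u v) (tensA y u v) = m * G y u u * G y v v)"
    using tensA_conformal by blast
  then obtain m where m: "\<And>y u v. y \<in> S \<Longrightarrow> u \<in> horizontal_space G y \<Longrightarrow> snd v = 0 \<Longrightarrow>
      G y (tensA y u v) (tensA y u v) = m y * G y u u * G y v v"
    by metis
  have "m x \<noteq> 0"
  proof
    assume "m x = 0"
    then have "tensA x u v = 0" if "u \<in> horizontal_space G x" "snd v = 0" for u v
      using m[OF xS that] G_eq_0_iff[OF xS] by simp
    then have "A_at G x u v = 0" for u v by (rule oneill_A_eq_0[OF xS])
    then show False
      using assms(8) \<kappa> x unfolding horizontally_nonintegrable_def G_def by blast
  qed
  then have "N x = 0" using N_eq_0[OF m xS _ assms(7)] by blast
  then have "T_at G x u v = 0"
    using T_at_vertical[OF \<open>foliated_domain S G\<close> xS] umbilic[OF xS] u v by (simp add: vertical_iff)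
  then show "T_at (g \<kappa>) x u v = 0" by (simp add: G_def)
qed

end
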